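(* Let $k\ge1$ be an integer, $0\le\alpha<1$, and let $f(z)=zh(z)\overline{g(z)}\in S^{k*}_{LH}(\alpha)$ with $\omega(0)=0$, where $h(z)=\exp\left(\sum_{n\ge1}a_{nk}z^{nk}\right)$ and $g(z)=\exp\left(\sum_{n\ge1}b_{nk}z^{nk}\right)$. Then for any real $\theta$, the inequality $$|z|\exp\left(\sum_{n=1}^{\infty}\left|a_{nk}+e^{i\theta}b_{nk}+k\,a_{nk}b_{nk}\right||z|^{nk}\right)\le d(f(0),\partial f(\mathbb{D}))$$ holds for $|z|\le r_1$, where $r_1$ is the unique root in $(0,1)$ of $$\frac{r\,2^{\frac{2\alpha}{k}}}{(1-r^{k})^{\frac{2\alpha(3-2\alpha)}{k}}}\exp\left(\frac1k\left[\frac{4(1-\alpha)(2-\alpha)r^{k}}{1-r^{k}}+(2\alpha-1)\mathrm{Li}_{2}(r^{k})+2(1-\alpha)\right]\right)=1.$$ The radius $r_1$ is the best possible.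
   Context: $\mathbb{D}=\{z\in\mathbb{C}:|z|<1\}$. A mapping $f$ on $\mathbb{D}$ is logharmonic if it solves $\overline{f_{\overline z}}/\overline{f}=\omega\, f_z/f$ for some analytic $\omega:\mathbb{D}\to\mathbb{C}$ with $|\omega|<1$, called the second dilatation of $f$. A mapping $f$ is $k$-fold symmetric if $f(e^{2\pi i/k}z)=e^{2\pi i/k}f(z)$. For an integer $k\ge1$ and $0\le\alpha<1$, $S^{k*}_{LH}(\alpha)$ is the class of univalent $k$-fold symmetric logharmonic mappings on $\mathbb{D}$ of the form $f(z)=zh(z)\overline{g(z)}$ with $h(z)=\exp\left(\sum_{n\ge1}a_{nk}z^{nk}\right)$ and $g(z)=\exp\left(\sum_{n\ge1}b_{nk}z^{nk}\right)$ analytic in $\mathbb{D}$, that are starlike of order $\alpha$: $\operatorname{Re}\left(\frac{zf_z(z)-\overline z f_{\overline z}(z)}{f(z)}\right)>\alpha$ for all $z\in\mathbb{D}$ (understood by its limit at $z=0$). $d$ is Euclidean distance in $\mathbb{C}$, $\partial f(\mathbb{D})$ is the boundary of $f(\mathbb{D})$, and $\mathrm{Li}_2(x)=\sum_{n\ge1}x^n/n^2$ is the dilogarithm. "Best possible" means that $r_1$ cannot be replaced by a larger number so that the inequality still holds for all such $f$ and all real $\theta$. *)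

theory Defs
  imports "HOL-Analysis.Analysis"
begin

abbreviation unit_disc :: "complex set" (\<open>\<bbbD>\<close>)
  where "\<bbbD> \<equiv> ball 0 1"

text \<open>Wirtinger derivatives; \<^const>\<open>frechet_derivative\<close> is the real-linear one here, so applying it
  to \<open>1\<close> and \<open>\<i>\<close> yields the partial derivatives in \<open>x\<close> and \<open>y\<close>.\<close>

definition deriv_z :: "(complex \<Rightarrow> complex) \<Rightarrow> complex \<Rightarrow> complex"
  where "deriv_z f z =
    (frechet_derivative f (at z) 1 - \<i> * frechet_derivative f (at z) \<i>) / 2"

definition deriv_zbar :: "(complex \<Rightarrow> complex) \<Rightarrow> complex \<Rightarrow> complex"
  where "deriv_zbar f z =
    (frechet_derivative f (at z) 1 + \<i> * frechet_derivative f (at z) \<i>) / 2"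

text \<open>Differentiability below is over the reals. The equation is only meaningful where \<open>f\<close> does
  not vanish.\<close>

definition logharmonic_with :: "(complex \<Rightarrow> complex) \<Rightarrow> (complex \<Rightarrow> complex) \<Rightarrow> bool"
  where "logharmonic_with \<omega> f \<longleftrightarrow>
    \<omega> holomorphic_on \<bbbD> \<and> (\<forall>z\<in>\<bbbD>. norm (\<omega> z) < 1) \<and>
    (\<forall>z\<in>\<bbbD>. f differentiable (at z)) \<and>
    (\<forall>z\<in>\<bbbD>. f z \<noteq> 0 \<longrightarrow> cnj (deriv_zbar f z) / cnj (f z) = \<omega> z * (deriv_z f z / f z))"

definition logharmonic :: "(complex \<Rightarrow> complex) \<Rightarrow> bool"
  where "logharmonic f \<longleftrightarrow> (\<exists>\<omega>. logharmonic_with \<omega> f)"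

definition fold_symmetric :: "nat \<Rightarrow> (complex \<Rightarrow> complex) \<Rightarrow> bool"
  where "fold_symmetric k f \<longleftrightarrow>
    (\<forall>z\<in>\<bbbD>. f (cis (2 * pi / real k) * z) = cis (2 * pi / real k) * f z)"

text \<open>The coefficient sequence \<open>c\<close> carries its full index: only its values at positive multiples of
  \<open>k\<close> are used. The summation index is shifted, so that it starts at \<open>1\<close>.\<close>

definition exp_gap_series :: "nat \<Rightarrow> (nat \<Rightarrow> complex) \<Rightarrow> (complex \<Rightarrow> complex) \<Rightarrow> bool"
  where "exp_gap_series k c h \<longleftrightarrow>
    h holomorphic_on \<bbbD> \<and>
    (\<forall>z\<in>\<bbbD>. summable (\<lambda>n. c (Suc n * k) * z ^ (Suc n * k)) \<and>
              h z = exp (\<Sum>n. c (Suc n * k) * z ^ (Suc n * k)))"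

definition logharmonic_form ::
    "nat \<Rightarrow> (nat \<Rightarrow> complex) \<Rightarrow> (nat \<Rightarrow> complex) \<Rightarrow> (complex \<Rightarrow> complex) \<Rightarrow> (complex \<Rightarrow> complex) \<Rightarrow>
     (complex \<Rightarrow> complex) \<Rightarrow> bool"
  where "logharmonic_form k a b h g f \<longleftrightarrow>
    exp_gap_series k a h \<and> exp_gap_series k b g \<and> (\<forall>z\<in>\<bbbD>. f z = z * h z * cnj (g z))"

definition starlike_quotient :: "(complex \<Rightarrow> complex) \<Rightarrow> complex \<Rightarrow> complex"
  where "starlike_quotient f z = (z * deriv_z f z - cnj z * deriv_zbar f z) / f z"

text \<open>At the origin, where \<open>f\<close> vanishes, the condition refers to the limit of the quotient.\<close>

definition starlike_of_order :: "real \<Rightarrow> (complex \<Rightarrow> complex) \<Rightarrow> bool"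
  where "starlike_of_order \<alpha> f \<longleftrightarrow>
    (\<forall>z\<in>\<bbbD> - {0}. Re (starlike_quotient f z) > \<alpha>) \<and>
    (\<exists>l. (starlike_quotient f \<longlongrightarrow> l) (at 0) \<and> Re l > \<alpha>)"

definition S_LH :: "nat \<Rightarrow> real \<Rightarrow> (complex \<Rightarrow> complex) set"
  where "S_LH k \<alpha> =
    {f. logharmonic f \<and> inj_on f \<bbbD> \<and> fold_symmetric k f \<and>
        (\<exists>a b h g. logharmonic_form k a b h g f) \<and> starlike_of_order \<alpha> f}"

definition dilog :: "real \<Rightarrow> real"
  where "dilog x = (\<Sum>n. x ^ Suc n / real (Suc n) ^ 2)"

definition bohr_function :: "nat \<Rightarrow> real \<Rightarrow> real \<Rightarrow> real"
  where "bohr_function k \<alpha> r =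
    r * 2 powr (2 * \<alpha> / real k) / (1 - r ^ k) powr (2 * \<alpha> * (3 - 2 * \<alpha>) / real k) *
    exp (1 / real k *
      (4 * (1 - \<alpha>) * (2 - \<alpha>) * r ^ k / (1 - r ^ k) + (2 * \<alpha> - 1) * dilog (r ^ k) + 2 * (1 - \<alpha>)))"

definition bohr_term ::
    "nat \<Rightarrow> (nat \<Rightarrow> complex) \<Rightarrow> (nat \<Rightarrow> complex) \<Rightarrow> real \<Rightarrow> complex \<Rightarrow> nat \<Rightarrow> real"
  where "bohr_term k a b \<theta> z n =
    norm (a (n * k) + cis \<theta> * b (n * k) + of_nat k * a (n * k) * b (n * k)) * norm z ^ (n * k)"

text \<open>Convergence of the series is made explicit because \<^const>\<open>suminf\<close> is unspecified on divergent
  series; a divergent series of nonnegative terms violates the inequality.\<close>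

definition bohr_inequality ::
    "nat \<Rightarrow> (nat \<Rightarrow> complex) \<Rightarrow> (nat \<Rightarrow> complex) \<Rightarrow> (complex \<Rightarrow> complex) \<Rightarrow> real \<Rightarrow> complex \<Rightarrow> bool"
  where "bohr_inequality k a b f \<theta> z \<longleftrightarrow>
    summable (\<lambda>n. bohr_term k a b \<theta> z (Suc n)) \<and>
    norm z * exp (\<Sum>n. bohr_term k a b \<theta> z (Suc n)) \<le> infdist (f 0) (frontier (f ` \<bbbD>))"

end

theory Submission
  imports Defs "HOL-Complex_Analysis.Complex_Analysis"
begin


text \<open>Put \<open>w = z\<^sup>k\<close> and write \<open>z f\<^sub>z / f = X(w)\<close>, where \<open>X = 1 + z h'/h\<close>, and \<open>Y = z g'/g\<close>. Then \<open>Y = \<omega> X\<close>, the function \<open>p = X - Y\<close>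
  has real part above \<open>\<alpha>\<close>, and \<open>c = Y/p = \<omega>/(1 - \<omega>)\<close> has real part above \<open>-1/2\<close>. Caratheodory's coefficient
  bounds for \<open>p\<close> and \<open>1 + 2c\<close> and the identities \<open>Y = c p\<close>, \<open>X = p + c p\<close> give sharp bounds for \<open>a\<^sub>n\<^sub>k\<close> and \<open>b\<^sub>n\<^sub>k\<close>,
  and summing the resulting majorant produces the left-hand side of the equation for the radius.
  Harnack's inequality for \<open>p\<close> and \<open>1 + 2c\<close>, applied at the minima of \<open>\<bar>f\<bar>\<close> on circles, gives a lower bound for \<open>\<bar>f\<bar>\<close>,
  hence for the distance to the boundary. All of these bounds are attained by the function with
  \<open>\<omega> = w\<close> and \<open>p = (1 + (1 - 2\<alpha>) w) / (1 - w)\<close>. It is univalent because its argument is that of the starlike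
  function \<open>z h/g\<close>, while its modulus increases along the rays in the image of \<open>z h/g\<close>.\<close>

subsection \<open>Functions with positive real part\<close>

text \<open>The equation for the radius says that the coefficient majorant equals the least
  distance. The factors 2^(2\<alpha>/k) and exp (2(1 - \<alpha>)/k) form the reciprocal of the
  distance bound exp (\<open>growth_exponent \<alpha> 1\<close> / k). The rest is the majorant: let
  A/k and B/k be the bounds for the moduli of the n-th coefficients, A = 2(1 - \<alpha>) + 1/n and B
  = 2(1 - \<alpha>) + (2\<alpha> - 1)/n. The weight k on the product makes the n-th term (A + B + A
  B)/k, whose parts of order 1, 1/n and 1/n^2 sum to the rational term, the power of 1 - r^k and the
  dilogarithm. Two obstacles shape the proof. Lower bounds for two real parts do not multiply to one
  for the real part of a product, so the growth bound cannot be integrated along arbitrary radii;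
  hence the minima on circles. And sharpness needs one member of the class attaining all bounds,
  whose univalence must be shown although it is not analytic. Logarithms being multivalued on the
  punctured disc, that argument is carried out in \<eta> = k log z on a half-plane, where k log (z
  h/g) is analytic with derivative p.\<close>

lemma has_fps_expansion_powser:
  fixes c :: "nat \<Rightarrow> complex"
  assumes "\<And>w. norm w < 1 \<Longrightarrow> (\<lambda>n. c n * w ^ n) sums q w"
  shows "q has_fps_expansion Abs_fps c"
proof (rule has_fps_expansionI)
  have "eventually (\<lambda>u::complex. u \<in> ball 0 1) (nhds 0)"
    by (intro eventually_nhds_in_open) auto
  then show "\<forall>\<^sub>F u in nhds 0. (\<lambda>n. fps_nth (Abs_fps c) n * u ^ n) sums q u"
    by eventually_elim (use assms in auto)
qed

lemma holomorphic_on_powser: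
  fixes c :: "nat \<Rightarrow> complex"
  assumes "\<And>w. norm w < 1 \<Longrightarrow> (\<lambda>n. c n * w ^ n) sums q w"
  shows "q holomorphic_on ball 0 1"
  by (rule power_series_holomorphic[where a = c]) (use assms in auto)

lemma powser_at_0:
  fixes c :: "nat \<Rightarrow> complex"
  assumes "\<And>w. norm w < 1 \<Longrightarrow> (\<lambda>n. c n * w ^ n) sums q w"
  shows "q 0 = c 0"
  using assms[of 0] powser_sums_zero_iff[of c "q 0"] by simp

lemma norm_cayley_less_1:
  assumes "0 < Re u"
  shows "norm ((u - 1) / (u + 1)) < 1"
proof -
  have nz: "u + 1 \<noteq> 0" using assms by (auto simp: complex_eq_iff)
  have "(norm (u - 1))\<^sup>2 < (norm (u + 1))\<^sup>2"
    unfolding cmod_power2 using assms by (simp add: power2_eq_square algebra_simps)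
  then have "norm (u - 1) < norm (u + 1)"
    using power_less_imp_less_base norm_ge_zero by blast
  then show ?thesis using nz by (simp add: norm_divide divide_simps)
qed

text \<open>The Cayley transform sends the right half-plane to the disc and 1 to 0, so Schwarz's
  lemma applies. Its growth part gives Harnack's inequality, its derivative part the bound for the
  first coefficient.\<close>

lemma cayley_schwarz:
  assumes "q holomorphic_on ball 0 1" "q 0 = 1" "\<And>w. norm w < 1 \<Longrightarrow> 0 < Re (q w)"
  shows "norm w < 1 \<Longrightarrow> norm ((q w - 1) / (q w + 1)) \<le> norm w"
    and "norm (deriv (\<lambda>w. (q w - 1) / (q w + 1)) 0) \<le> 1"
proof -
  have nz: "q w + 1 \<noteq> 0" if "norm w < 1" for w
    using assms(3)[OF that] by (auto simp: complex_eq_iff)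
  have hol: "(\<lambda>w. (q w - 1) / (q w + 1)) holomorphic_on ball 0 1"
    by (intro holomorphic_intros assms) (use nz in auto)
  note S = Schwarz_Lemma[OF hol _ norm_cayley_less_1[OF assms(3)]]
  show "norm w < 1 \<Longrightarrow> norm ((q w - 1) / (q w + 1)) \<le> norm w"
    by (rule S(1)) (use assms in auto)
  show "norm (deriv (\<lambda>w. (q w - 1) / (q w + 1)) 0) \<le> 1"
    by (rule S(2)[of 0]) (use assms in auto)
qed

text \<open>Solving the Cayley transform for q gives q = (1 + s)/(1 - s) with |s| \<le> |w|. The
  real part is (1 - |s|^2)/|1 - s|^2, at least (1 - |s|)/(1 + |s|), which decreases in |s|.\<close>

lemma harnack_lower_bound:
  assumes "q holomorphic_on ball 0 1" "q 0 = 1" "\<And>w. norm w < 1 \<Longrightarrow> 0 < Re (q w)"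
    and w: "norm w < 1"
  shows "(1 - norm w) / (1 + norm w) \<le> Re (q w)"
proof -
  define s where "s = (q w - 1) / (q w + 1)"
  have nz: "q w + 1 \<noteq> 0" using assms(3)[OF w] by (auto simp: complex_eq_iff)
  have s: "norm s \<le> norm w" unfolding s_def by (rule cayley_schwarz) fact+
  then have s1: "norm s < 1" using w by simp
  then have nz': "1 - s \<noteq> 0" by auto
  have q: "q w = (1 + s) / (1 - s)"
    using nz nz' unfolding s_def by (simp add: divide_simps)
  have "Re (q w) = (1 - (norm s)\<^sup>2) / (norm (1 - s))\<^sup>2"
    unfolding q Re_divide cmod_power2 by (simp add: power2_eq_square algebra_simps)
  also have "\<dots> \<ge> (1 - (norm s)\<^sup>2) / (1 + norm s)\<^sup>2"
  proof (rule divide_left_mono)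
    show "(norm (1 - s))\<^sup>2 \<le> (1 + norm s)\<^sup>2"
      using norm_triangle_ineq4[of 1 s] by (intro power_mono) auto
    show "0 \<le> 1 - (norm s)\<^sup>2" using s1 by (simp add: power_le_one)
  qed (use nz' norm_ge_zero[of s] in \<open>auto intro!: mult_pos_pos simp: add_nonneg_eq_0_iff\<close>)
  also have "(1 - (norm s)\<^sup>2) / (1 + norm s)\<^sup>2 = (1 - norm s) / (1 + norm s)"
    using norm_ge_zero[of s] by (simp add: divide_simps power2_eq_square) (simp add: algebra_simps)
  also have "\<dots> \<ge> (1 - norm w) / (1 + norm w)"
    using s s1 norm_ge_zero[of s] by (intro frac_le) linarith+
  finally show ?thesis by linarith
qed

text \<open>Since q(0) = 1, the Cayley transform of q has derivative c_1/2 at 0, which Schwarz's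
  lemma bounds by 1.\<close>

lemma caratheodory_first_coeff:
  fixes c :: "nat \<Rightarrow> complex"
  assumes sums: "\<And>w. norm w < 1 \<Longrightarrow> (\<lambda>n. c n * w ^ n) sums q w"
    and "c 0 = 1" and pos: "\<And>w. norm w < 1 \<Longrightarrow> 0 < Re (q w)"
  shows "norm (c 1) \<le> 2"
proof -
  have q0: "q 0 = 1" using powser_at_0[OF sums] assms(2) by simp
  have hol: "q holomorphic_on ball 0 1" by (rule holomorphic_on_powser[OF sums])
  have "fps_nth (Abs_fps c) 1 = (deriv ^^ 1) q 0 / fact 1"
    by (rule fps_nth_fps_expansion[OF has_fps_expansion_powser[OF sums]])
  then have "deriv q 0 = c 1" by simp
  then have D: "(q has_field_derivative c 1) (at 0)"
    using holomorphic_derivI[OF hol, of 0] by simp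
  have "((\<lambda>w. (q w - 1) / (q w + 1)) has_field_derivative c 1 / 2) (at 0)"
    by (rule derivative_eq_intros D refl | simp add: q0)+
  then have "deriv (\<lambda>w. (q w - 1) / (q w + 1)) 0 = c 1 / 2" by (rule DERIV_imp_deriv)
  with cayley_schwarz(2)[OF hol q0 pos] show ?thesis by (simp add: norm_divide)
qed

lemma sum_roots_of_unity_power:
  assumes "n > 0"
  shows "(\<Sum>j<n. cis (2 * pi * real j / real n) ^ m) = (if n dvd m then of_nat n else 0)"
proof -
  define \<epsilon> where "\<epsilon> = cis (2 * pi * real m / real n)"
  have "cis (2 * pi * real j / real n) ^ m = \<epsilon> ^ j" for j
    unfolding \<epsilon>_def Complex.DeMoivre by (simp add: algebra_simps)
  then have eq: "(\<Sum>j<n. cis (2 * pi * real j / real n) ^ m) = (\<Sum>j<n. \<epsilon> ^ j)" by simp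
  have \<epsilon>: "\<epsilon> = exp (2 * of_real pi * \<i> * of_nat m / of_nat n)"
    unfolding \<epsilon>_def cis_conv_exp by (simp add: algebra_simps)
  have "\<epsilon> ^ n = cis (2 * pi * real m)"
    unfolding \<epsilon>_def Complex.DeMoivre using assms by (simp add: algebra_simps)
  then have pn: "\<epsilon> ^ n = 1" by (simp add: cis_multiple_2pi)
  have one: "\<epsilon> = 1 \<longleftrightarrow> n dvd m"
    unfolding \<epsilon> using complex_root_unity_eq_1[of n m] assms by simp
  show ?thesis
  proof (cases "n dvd m")
    case False
    then show ?thesis using one pn by (simp add: eq geometric_sum)
  qed (use one eq in simp)
qed

text \<open>Averaging over the rotations by \<open>n\<close>-th roots of unity keeps only the coefficients whose index
  is a multiple of \<open>n\<close>, which reduces the claim to the first coefficient.\<close>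

lemma caratheodory_coeff_bound:
  fixes c :: "nat \<Rightarrow> complex"
  assumes sums: "\<And>w. norm w < 1 \<Longrightarrow> (\<lambda>n. c n * w ^ n) sums q w"
    and c0: "c 0 = 1" and pos: "\<And>w. norm w < 1 \<Longrightarrow> 0 < Re (q w)" and n: "0 < n"
  shows "norm (c n) \<le> 2"
proof -
  define e where "e j = cis (2 * pi * real j / real n)" for j
  define Q where "Q x = (\<Sum>m. c (n * m) * x ^ m)" for x
  have key: "(\<lambda>m. c (n * m) * (w ^ n) ^ m) sums ((\<Sum>j<n. q (e j * w)) / of_nat n)"
    if w: "norm w < 1" for w
  proof -
    have "(\<lambda>m. \<Sum>j<n. c m * (e j * w) ^ m) sums (\<Sum>j<n. q (e j * w))"
      by (intro sums_sum sums) (use w in \<open>simp add: norm_mult e_def\<close>)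
    then have "(\<lambda>m. (\<Sum>j<n. c m * (e j * w) ^ m) / of_nat n) sums ((\<Sum>j<n. q (e j * w)) / of_nat n)"
      by (rule sums_divide)
    moreover have "(\<Sum>j<n. c m * (e j * w) ^ m) / of_nat n = (if n dvd m then c m * w ^ m else 0)" for m
    proof -
      have "(\<Sum>j<n. c m * (e j * w) ^ m) = c m * w ^ m * (\<Sum>j<n. e j ^ m)"
        by (simp add: power_mult_distrib sum_distrib_left algebra_simps)
      then show ?thesis
        using sum_roots_of_unity_power[OF n, of m] n by (simp add: e_def)
    qed
    ultimately have *: "(\<lambda>m. if n dvd m then c m * w ^ m else 0) sums ((\<Sum>j<n. q (e j * w)) / of_nat n)"
      by simp
    have "(\<lambda>m. (\<lambda>m. if n dvd m then c m * w ^ m else 0) (n * m)) sums ((\<Sum>j<n. q (e j * w)) / of_nat n)"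
      by (subst sums_mono_reindex) (use * n in \<open>auto simp: strict_mono_def\<close>)
    then show ?thesis by (simp add: power_mult)
  qed
  \<comment> \<open>Each x is w^n for some w in the disc, and Q(x) is the mean of q over the n
    rotations of w, so its real part is positive. The choice of the root is immaterial because Q is
    defined by its series.\<close>
  have main: "(\<lambda>m. c (n * m) * x ^ m) sums Q x \<and> 0 < Re (Q x)" if x: "norm x < 1" for x
  proof -
    obtain w where w: "w ^ n = x" using n exists_complex_root[of n x] by auto
    have nw: "norm w < 1"
      using x n unfolding w[symmetric] norm_power by (metis norm_ge_zero not_le one_le_power)
    have "0 < Re ((\<Sum>j<n. q (e j * w)) / of_nat n)"
      using n nw by (auto simp: Re_divide_of_nat e_def norm_mult intro!: divide_pos_pos sum_pos pos)
    moreover have "(\<lambda>m. c (n * m) * x ^ m) sums ((\<Sum>j<n. q (e j * w)) / of_nat n)"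
      using key[OF nw] by (simp add: w)
    ultimately show ?thesis unfolding Q_def by (auto simp: sums_iff)
  qed
  have "norm (c (n * 1)) \<le> 2"
    by (rule caratheodory_first_coeff[where q = Q and c = "\<lambda>m. c (n * m)"]) (use main c0 in auto)
  then show ?thesis by simp
qed


subsection \<open>Coefficient and growth estimates\<close>

text \<open>The hypothesis says that u is nearer to 0 than to -1, that is, Re u > -1/2.\<close>

lemma Re_pos_if_norm_less:
  assumes "norm u < norm (1 + u)"
  shows "0 < Re (1 + 2 * u)"
proof -
  have "(norm u)\<^sup>2 < (norm (1 + u))\<^sup>2" using assms by (intro power_strict_mono) auto
  then show ?thesis unfolding cmod_power2 by (simp add: power2_eq_square algebra_simps)
qed

text \<open>With \<open>X = 1 + z h'/h\<close>, \<open>Y = z g'/g\<close> and \<open>\<omega> = Y/X\<close> the quotient below is \<open>\<omega>/(1 - \<omega>)\<close>.\<close>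

lemma dilatation_quotient:
  fixes X Y :: "complex \<Rightarrow> complex"
  assumes "X holomorphic_on ball 0 1" "Y holomorphic_on ball 0 1" "Y 0 = 0" "0 \<le> \<alpha>"
    and less: "\<And>w. norm w < 1 \<Longrightarrow> norm (Y w) < norm (X w)"
    and re: "\<And>w. norm w < 1 \<Longrightarrow> \<alpha> < Re (X w - Y w)"
  obtains c where "c holomorphic_on ball 0 1" "c 0 = 0"
    "\<And>w. norm w < 1 \<Longrightarrow> Y w = c w * (X w - Y w)"
    "\<And>w. norm w < 1 \<Longrightarrow> 0 < Re (1 + 2 * c w)"
proof
  have nz: "X w - Y w \<noteq> 0" if "norm w < 1" for w
    using re[OF that] assms(4) by (auto simp: complex_eq_iff)
  show "(\<lambda>w. Y w / (X w - Y w)) holomorphic_on ball 0 1"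
    by (intro holomorphic_intros assms) (use nz in auto)
  show "Y 0 / (X 0 - Y 0) = 0" by (simp add: assms)
  fix w :: complex assume w: "norm w < 1"
  let ?c = "Y w / (X w - Y w)"
  show *: "Y w = ?c * (X w - Y w)" using nz[OF w] by simp
  \<comment> \<open>With p = X - Y the two quotients are \<open>?c\<close> = Y/p and 1 +
    \<open>?c\<close> = X/p, so |Y| < |X| turns into |\<open>?c\<close>| < |1 +
    \<open>?c\<close>|.\<close>
  have X: "X w = (1 + ?c) * (X w - Y w)" using nz[OF w] by (simp add: field_simps)
  have "norm (?c * (X w - Y w)) < norm ((1 + ?c) * (X w - Y w))"
    using less[OF w] X * by metis
  then have "norm ?c * norm (X w - Y w) < norm (1 + ?c) * norm (X w - Y w)"
    by (simp only: norm_mult)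
  then have "norm ?c < norm (1 + ?c)" by (rule mult_right_less_imp_less) simp
  then show "0 < Re (1 + 2 * ?c)" by (rule Re_pos_if_norm_less)
qed

text \<open>The sequence y is the Cauchy product of the coefficients of c and p, which at positive
  indices are bounded by 1 and 2(1 - \<alpha>); moreover x = p + y.\<close>

lemma starlike_coeff_bounds:
  fixes x y :: "nat \<Rightarrow> complex"
  assumes X: "\<And>w. norm w < 1 \<Longrightarrow> (\<lambda>n. x n * w ^ n) sums X w"
    and Y: "\<And>w. norm w < 1 \<Longrightarrow> (\<lambda>n. y n * w ^ n) sums Y w"
    and x0: "x 0 = 1" and y0: "y 0 = 0" and \<alpha>: "0 \<le> \<alpha>" "\<alpha> < 1"
    and less: "\<And>w. norm w < 1 \<Longrightarrow> norm (Y w) < norm (X w)"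
    and re: "\<And>w. norm w < 1 \<Longrightarrow> \<alpha> < Re (X w - Y w)"
  shows "norm (x (Suc n)) \<le> 2 * (1 - \<alpha>) * real (Suc n) + 1"
    and "norm (y (Suc n)) \<le> 2 * (1 - \<alpha>) * real n + 1"
proof -
  have Y0: "Y 0 = 0" using powser_at_0[OF Y] y0 by simp
  obtain c where c: "c holomorphic_on ball 0 1" "c 0 = 0"
    "\<And>w. norm w < 1 \<Longrightarrow> Y w = c w * (X w - Y w)"
    "\<And>w. norm w < 1 \<Longrightarrow> 0 < Re (1 + 2 * c w)"
    using dilatation_quotient[OF holomorphic_on_powser[OF X] holomorphic_on_powser[OF Y] Y0 \<alpha>(1) less re]
    by blast
  define C where "C n = (deriv ^^ n) c 0 / fact n" for n
  have C: "(\<lambda>n. C n * w ^ n) sums c w" if "norm w < 1" for w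
    using holomorphic_power_series[OF c(1), of w] that unfolding C_def by simp
  have C0: "C 0 = 0" using c(2) by (simp add: C_def)
  define p where "p n = x n - y n" for n
  have p: "(\<lambda>n. p n * w ^ n) sums (X w - Y w)" if "norm w < 1" for w
    using sums_diff[OF X[OF that] Y[OF that]] by (simp add: p_def algebra_simps)
  have p0: "p 0 = 1" using x0 y0 by (simp add: p_def)
  have p_bound: "norm (p m) \<le> 2 * (1 - \<alpha>)" if "0 < m" for m
  proof -
    \<comment> \<open>Subtracting \<alpha> and dividing by 1 - \<alpha> turns p into a function of
      positive real part with value 1 at 0.\<close>
    define q where "q n = (p n - (if n = 0 then of_real \<alpha> else 0)) / of_real (1 - \<alpha>)" for n
    have "norm (q m) \<le> 2"
    proof (rule caratheodory_coeff_bound[where q = "\<lambda>w. (X w - Y w - of_real \<alpha>) / of_real (1 - \<alpha>)"])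
      fix w :: complex assume w: "norm w < 1"
      have "(\<lambda>n. (if n = 0 then of_real \<alpha> else 0) * w ^ n) sums of_real \<alpha>"
        using sums_If_finite[of "\<lambda>n. n = 0" "\<lambda>n. of_real \<alpha> * w ^ n"] by (simp add: if_distrib if_distribR cong: if_cong)
      from sums_divide[OF sums_diff[OF p[OF w] this], of "of_real (1 - \<alpha>)"]
      show "(\<lambda>n. q n * w ^ n) sums ((X w - Y w - of_real \<alpha>) / of_real (1 - \<alpha>))"
        by (simp add: q_def algebra_simps diff_divide_distrib)
      show "0 < Re ((X w - Y w - of_real \<alpha>) / of_real (1 - \<alpha>))"
        using re[OF w] \<alpha> by (simp add: Re_divide_of_real del: of_real_diff)
    qed (use \<alpha> p0 that in \<open>auto simp: q_def\<close>)
    then show ?thesis using that \<alpha>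
      by (simp add: q_def norm_divide divide_simps mult.commute del: of_real_diff)
  qed
  have C_bound: "norm (C m) \<le> 1" if "0 < m" for m
  proof -
    \<comment> \<open>These are the coefficients of 1 + 2c; the conditional supplies its constant
      term.\<close>
    have "norm (2 * C m + (if m = 0 then 1 else 0)) \<le> 2"
    proof (rule caratheodory_coeff_bound[where q = "\<lambda>w. 1 + 2 * c w" and c = "\<lambda>m. 2 * C m + (if m = 0 then 1 else 0)"])
      fix w :: complex assume w: "norm w < 1"
      have "(\<lambda>n. (if n = 0 then 1 else 0) * w ^ n) sums 1"
        using sums_If_finite[of "\<lambda>n. n = 0" "\<lambda>n. w ^ n"] by (simp add: if_distrib if_distribR cong: if_cong)
      from sums_add[OF this sums_mult[OF C[OF w], of 2]]
      show "(\<lambda>n. (2 * C n + (if n = 0 then 1 else 0)) * w ^ n) sums (1 + 2 * c w)"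
        by (simp add: algebra_simps)
    qed (use c(4) C0 that in auto)
    then show ?thesis using that by (simp add: norm_mult)
  qed
  have conv: "y m = (\<Sum>i=0..m. C i * p (m - i))" for m
  proof -
    have 1: "(\<lambda>w. c w * (X w - Y w)) has_fps_expansion Abs_fps C * Abs_fps p"
      by (intro has_fps_expansion_mult has_fps_expansion_powser C p)
    have ev: "\<forall>\<^sub>F w in nhds 0. Y w = c w * (X w - Y w)"
      using eventually_nhds_in_open[of "ball (0::complex) 1" 0] by (rule eventually_mono) (use c(3) in auto)
    have "Y has_fps_expansion Abs_fps C * Abs_fps p"
      using has_fps_expansion_cong[OF ev refl] 1 by blast
    then have "Abs_fps y = Abs_fps C * Abs_fps p"
      using has_fps_expansion_powser[OF Y] by (metis fps_expansion_unique_complex)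
    then have "fps_nth (Abs_fps y) m = fps_nth (Abs_fps C * Abs_fps p) m" by simp
    then show ?thesis by (simp add: fps_mult_nth)
  qed
  show y_bound: "norm (y (Suc n)) \<le> 2 * (1 - \<alpha>) * real n + 1"
  proof -
    \<comment> \<open>Index 0 drops out because \<open>C 0 = 0\<close>, and index
      \<open>Suc n\<close> contributes \<open>C (Suc n)\<close> alone because
      \<open>p 0 = 1\<close>. There remain n terms, each at most 2(1 - \<alpha>).\<close>
    have "y (Suc n) = C (Suc n) + (\<Sum>i=Suc 0..n. C i * p (Suc n - i))"
      unfolding conv[of "Suc n"] by (simp add: sum.atLeast_Suc_atMost[of 0] C0 p0)
    also have "norm \<dots> \<le> norm (C (Suc n)) + norm (\<Sum>i=Suc 0..n. C i * p (Suc n - i))"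
      by (rule norm_triangle_ineq)
    also have "\<dots> \<le> 1 + (\<Sum>i=Suc 0..n. 2 * (1 - \<alpha>))"
    proof (intro add_mono C_bound sum_norm_le)
      fix i assume i: "i \<in> {Suc 0..n}"
      have "norm (C i) * norm (p (Suc n - i)) \<le> 1 * (2 * (1 - \<alpha>))"
        using i \<alpha> by (intro mult_mono C_bound p_bound) auto
      then show "norm (C i * p (Suc n - i)) \<le> 2 * (1 - \<alpha>)" by (simp add: norm_mult)
    qed simp
    finally show ?thesis by (simp add: algebra_simps)
  qed
  have "norm (x (Suc n)) = norm (p (Suc n) + y (Suc n))" by (simp add: p_def)
  also have "\<dots> \<le> 2 * (1 - \<alpha>) + (2 * (1 - \<alpha>) * real n + 1)"
    by (intro norm_triangle_le add_mono p_bound y_bound) simp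
  finally show "norm (x (Suc n)) \<le> 2 * (1 - \<alpha>) * real (Suc n) + 1"
    by (simp add: algebra_simps)
qed

text \<open>The primitive, zero at 0, of (P Q - 1)/r, where P = (1 + (2\<alpha> - 1) r)/(1 + r) and
  Q = (1 - r)/(1 + r) are Harnack's bounds for p and 1 + 2c. For the extremal function it is the
  value of Re L at w = -r.\<close>

definition growth_exponent :: "real \<Rightarrow> real \<Rightarrow> real"
  where "growth_exponent \<alpha> r = - 2 * \<alpha> * ln (1 + r) - 4 * (1 - \<alpha>) * (r / (1 + r))"

lemma growth_exponent_derivative:
  assumes "0 \<le> r"
  shows "(growth_exponent \<alpha> has_real_derivative - 2 * \<alpha> / (1 + r) - 4 * (1 - \<alpha>) / (1 + r)\<^sup>2) (at r)"
  unfolding growth_exponent_def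
  by (rule derivative_eq_intros refl | use assms in \<open>simp add: power2_eq_square\<close>)+

lemma growth_exponent_antimono:
  assumes "0 \<le> r" "r \<le> s" "0 \<le> \<alpha>" "\<alpha> < 1"
  shows "growth_exponent \<alpha> s \<le> growth_exponent \<alpha> r"
proof -
  have 1: "r / (1 + r) \<le> s / (1 + s)" using assms by (simp add: divide_simps) (simp add: algebra_simps)
  have 2: "ln (1 + r) \<le> ln (1 + s)" using assms by simp
  have "0 \<le> 4 * (1 - \<alpha>)" "0 \<le> 2 * \<alpha>" using assms by auto
  from mult_left_mono[OF 1 this(1)] mult_left_mono[OF 2 this(2)]
  show ?thesis unfolding growth_exponent_def by linarith
qed

text \<open>At a minimum of \<open>Re L\<close> on a circle the number \<open>w L'(w) + 1 = (X - Y) (1 + 2c)\<close> is real, so its real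
  part is at least the product of the real parts of the two factors, for which Harnack's bound is
  available. The \<open>\<epsilon>\<close> makes the radial derivative strictly positive at such a minimum.\<close>

lemma logharmonic_growth:
  fixes X Y L :: "complex \<Rightarrow> complex"
  assumes X: "X holomorphic_on ball 0 1" "X 0 = 1" and Y: "Y holomorphic_on ball 0 1" "Y 0 = 0"
    and L: "L holomorphic_on ball 0 1" "L 0 = 0"
    and dL: "\<And>w. norm w < 1 \<Longrightarrow> w * deriv L w = X w + Y w - 1"
    and \<alpha>: "0 \<le> \<alpha>" "\<alpha> < 1"
    and less: "\<And>w. norm w < 1 \<Longrightarrow> norm (Y w) < norm (X w)"
    and re: "\<And>w. norm w < 1 \<Longrightarrow> \<alpha> < Re (X w - Y w)"
    and w: "norm w < 1"
  shows "growth_exponent \<alpha> (norm w) \<le> Re (L w)"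
proof -
  obtain c where c: "c holomorphic_on ball 0 1" "c 0 = 0"
    "\<And>w. norm w < 1 \<Longrightarrow> Y w = c w * (X w - Y w)"
    "\<And>w. norm w < 1 \<Longrightarrow> 0 < Re (1 + 2 * c w)"
    using dilatation_quotient[OF X(1) Y \<alpha>(1) less re] by blast
  have XY: "X u + Y u = (X u - Y u) * (1 + 2 * c u)" if "norm u < 1" for u
  proof -
    have "(X u - Y u) * (1 + 2 * c u) = X u - Y u + 2 * (c u * (X u - Y u))" by (simp add: algebra_simps)
    then show ?thesis unfolding c(3)[OF that, symmetric] by simp
  qed
  have T: "(1 - norm u) / (1 + norm u) \<le> Re (1 + 2 * c u)" if "norm u < 1" for u
    by (rule harnack_lower_bound) (use c that in \<open>auto intro!: holomorphic_intros\<close>)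
  have p: "(1 + (2 * \<alpha> - 1) * norm u) / (1 + norm u) \<le> Re (X u - Y u)" if u: "norm u < 1" for u
  proof -
    have "(1 - norm u) / (1 + norm u) \<le> Re ((X u - Y u - of_real \<alpha>) / of_real (1 - \<alpha>))"
    proof (rule harnack_lower_bound)
      show "(\<lambda>u. (X u - Y u - of_real \<alpha>) / of_real (1 - \<alpha>)) holomorphic_on ball 0 1"
        by (intro holomorphic_intros X Y) (use \<alpha> in \<open>simp del: of_real_diff\<close>)
      show "0 < Re ((X v - Y v - of_real \<alpha>) / of_real (1 - \<alpha>))" if "norm v < 1" for v
        using re[OF that] \<alpha> by (simp add: Re_divide_of_real del: of_real_diff)
      have "X 0 - Y 0 - of_real \<alpha> = of_real (1 - \<alpha>)" using X Y by simp
      then show "(X 0 - Y 0 - of_real \<alpha>) / of_real (1 - \<alpha>) = 1"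
        using \<alpha> by (simp del: of_real_diff)
    qed fact
    also have "\<dots> = (Re (X u - Y u) - \<alpha>) / (1 - \<alpha>)"
      by (simp add: Re_divide_of_real del: of_real_diff)
    finally have "(1 - \<alpha>) * ((1 - norm u) / (1 + norm u)) + \<alpha> \<le> Re (X u - Y u)"
      using \<alpha> by (simp add: field_simps)
    moreover have "(1 - \<alpha>) * ((1 - norm u) / (1 + norm u)) + \<alpha> = (1 + (2 * \<alpha> - 1) * norm u) / (1 + norm u)"
      using norm_ge_zero[of u] by (simp add: divide_simps add_nonneg_eq_0_iff) (simp add: algebra_simps)
    ultimately show ?thesis by linarith
  qed
  have lower: "norm u * (- 2 * \<alpha> / (1 + norm u) - 4 * (1 - \<alpha>) / (1 + norm u)\<^sup>2) \<le> Re (u * deriv L u)"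
    if u: "norm u < 1" and im: "Im (u * deriv L u) = 0" for u
  proof -
    define P where "P = X u - Y u"
    define Q where "Q = 1 + 2 * c u"
    have PQ: "u * deriv L u = P * Q - 1" using dL[OF u] XY[OF u] by (simp add: P_def Q_def)
    have rP: "0 < Re P" using re[OF u] \<alpha> by (simp add: P_def)
    have rQ: "0 < Re Q" using c(4)[OF u] by (simp add: Q_def)
    \<comment> \<open>As P Q is real and both real parts are positive, the imaginary parts cannot
      have the same sign, so Re (P Q) = Re P Re Q - Im P Im Q is at least Re P Re Q.\<close>
    have "Re P * Im Q = - (Im P * Re Q)" using im unfolding PQ by simp
    then have "Re P * (Im P * Im Q) = - ((Im P)\<^sup>2 * Re Q)"
      by (metis (no_types, lifting) mult.assoc mult.commute mult_minus_right power2_eq_square)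
    then have "Re P * (Im P * Im Q) \<le> 0" using rQ by simp
    then have "Im P * Im Q \<le> 0" using rP by (simp add: mult_le_0_iff)
    then have "Re P * Re Q \<le> Re (P * Q)" by simp
    moreover have "(1 + (2 * \<alpha> - 1) * norm u) / (1 + norm u) * ((1 - norm u) / (1 + norm u)) \<le> Re P * Re Q"
    proof (rule mult_mono)
      show "(1 + (2 * \<alpha> - 1) * norm u) / (1 + norm u) \<le> Re P" using p[OF u] by (simp add: P_def)
      show "(1 - norm u) / (1 + norm u) \<le> Re Q" using T[OF u] by (simp add: Q_def)
    qed (use u rP in auto)
    moreover have "(1 + (2 * \<alpha> - 1) * norm u) / (1 + norm u) * ((1 - norm u) / (1 + norm u)) - 1
        = norm u * (- 2 * \<alpha> / (1 + norm u) - 4 * (1 - \<alpha>) / (1 + norm u)\<^sup>2)"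
      using norm_ge_zero[of u]
      by (simp add: divide_simps add_nonneg_eq_0_iff) (simp add: power2_eq_square algebra_simps)
    ultimately show ?thesis unfolding PQ by simp
  qed
  show ?thesis
  proof (rule ccontr)
    assume "\<not> ?thesis"
    then have neg: "Re (L w) - growth_exponent \<alpha> (norm w) < 0" by simp
    have w0: "w \<noteq> 0" using neg L(2) by (auto simp: growth_exponent_def)
    \<comment> \<open>Half of the deficit at w, spread over the radius: V at w is minus half the
      deficit, hence still negative.\<close>
    define \<epsilon> where "\<epsilon> = (growth_exponent \<alpha> (norm w) - Re (L w)) / (2 * norm w)"
    have \<epsilon>: "0 < \<epsilon>" using neg w0 by (simp add: \<epsilon>_def)
    define V where "V u = Re (L u) - growth_exponent \<alpha> (norm u) + \<epsilon> * norm u" for u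
    have Vw: "V w < 0" using neg w0 by (simp add: V_def \<epsilon>_def field_simps)
    have sub: "cball 0 (norm w) \<subseteq> ball (0::complex) 1" using w by auto
    have "continuous_on (cball 0 (norm w)) L"
      by (meson L(1) holomorphic_on_imp_continuous_on continuous_on_subset sub)
    then have "continuous_on (cball 0 (norm w)) V"
      unfolding V_def growth_exponent_def
      by (intro continuous_intros) (auto simp: add_nonneg_eq_0_iff)
    then obtain u where u: "norm u \<le> norm w" and umin: "\<And>v. norm v \<le> norm w \<Longrightarrow> V u \<le> V v"
      using continuous_attains_inf[of "cball 0 (norm w)" V] by auto
    have u1: "norm u < 1" using u w by simp
    \<comment> \<open>V vanishes at 0, so its negative minimum lies elsewhere.\<close>
    have u0: "u \<noteq> 0" using umin[of w] Vw L(2) by (auto simp: V_def growth_exponent_def)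
    have DL: "(L has_field_derivative deriv L u) (at u)"
      using holomorphic_derivI[OF L(1), of u] u1 by simp
    \<comment> \<open>On the circle through u the other terms of V are constant, so Re L itself is
      minimal at u and its angular derivative vanishes.\<close>
    have "((\<lambda>t. Re (L (u * cis t))) has_real_derivative Re (deriv L u * (u * \<i>))) (at 0)"
    proof -
      have "((\<lambda>z. L (u * exp (\<i> * z))) has_field_derivative deriv L u * (u * \<i>)) (at (of_real 0))"
        by (rule DERIV_chain2[where f = L]) (use DL in \<open>auto intro!: derivative_eq_intros\<close>)
      from has_vector_derivative_real_field[OF this]
      have "((\<lambda>t. L (u * cis t)) has_vector_derivative deriv L u * (u * \<i>)) (at 0)"
        by (simp add: cis_conv_exp)
      from bounded_linear.has_vector_derivative[OF bounded_linear_Re this]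
      show ?thesis by (simp add: has_real_derivative_iff_has_vector_derivative mult.commute)
    qed
    then have "Re (deriv L u * (u * \<i>)) = 0"
    proof (rule DERIV_local_min[of _ _ _ 1])
      show "\<forall>t. \<bar>0 - t\<bar> < 1 \<longrightarrow> Re (L (u * cis 0)) \<le> Re (L (u * cis t))"
        using umin[of "u * cis _"] u by (simp add: V_def norm_mult)
    qed simp
    then have im: "Im (u * deriv L u) = 0" by (simp add: algebra_simps)
    define D where "D = Re (u * deriv L u)
      - norm u * (- 2 * \<alpha> / (1 + norm u) - 4 * (1 - \<alpha>) / (1 + norm u)\<^sup>2) + \<epsilon> * norm u"
    have "((\<lambda>t. V (of_real t * u)) has_real_derivative D) (at 1)"
    proof -
      have "((\<lambda>z. L (z * u)) has_field_derivative deriv L u * u) (at (of_real 1))"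
        by (rule DERIV_chain2[where f = L]) (use DL in \<open>auto intro!: derivative_eq_intros\<close>)
      from has_vector_derivative_real_field[OF this]
      have "((\<lambda>t. L (of_real t * u)) has_vector_derivative u * deriv L u) (at 1)"
        by (simp add: mult.commute)
      from bounded_linear.has_vector_derivative[OF bounded_linear_Re this]
      have 2: "((\<lambda>t. Re (L (of_real t * u))) has_real_derivative Re (u * deriv L u)) (at 1)"
        by (simp add: has_real_derivative_iff_has_vector_derivative)
      have "((\<lambda>t. growth_exponent \<alpha> (t * norm u)) has_real_derivative
          (- 2 * \<alpha> / (1 + norm u) - 4 * (1 - \<alpha>) / (1 + norm u)\<^sup>2) * norm u) (at 1)"
        by (rule DERIV_chain2[where f = "growth_exponent \<alpha>"])
           (use growth_exponent_derivative[of "norm u" \<alpha>] in \<open>auto intro!: derivative_eq_intros\<close>)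
      note 3 = DERIV_diff[OF 2 this]
      have "((\<lambda>t. \<epsilon> * (t * norm u)) has_real_derivative \<epsilon> * norm u) (at 1)"
        by (auto intro!: derivative_eq_intros)
      from DERIV_add[OF 3 this]
      have 4: "((\<lambda>t. Re (L (of_real t * u)) - growth_exponent \<alpha> (t * norm u) + \<epsilon> * (t * norm u))
          has_real_derivative D) (at 1)"
        by (simp only: D_def mult.commute[of "norm u" "_ - _"])
      have "\<forall>\<^sub>F t::real in nhds 1. t > 0"
        using eventually_nhds_in_open[of "{0::real<..}" 1] by simp
      then have "\<forall>\<^sub>F t in nhds 1. V (of_real t * u)
          = Re (L (of_real t * u)) - growth_exponent \<alpha> (t * norm u) + \<epsilon> * (t * norm u)"
        by eventually_elim (simp add: V_def norm_mult)
      then show ?thesis using 4 by (subst DERIV_cong_ev) auto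
    qed
    moreover have "0 < D"
      using lower[OF u1 im] \<epsilon> u0 by (simp add: D_def add_nonneg_pos)
    \<comment> \<open>A positive radial derivative makes V smaller just inside u. Inward points stay
      in the disc over which V was minimised, even if u lies on its boundary circle.\<close>
    ultimately obtain d where d: "d > 0" "\<And>t. 0 < t \<Longrightarrow> t < d \<Longrightarrow> V (of_real (1 - t) * u) < V (of_real 1 * u)"
      using DERIV_pos_inc_left by blast
    define t where "t = min d 1 / 2"
    have t: "0 < t" "t < d" "t < 1" using d(1) by (auto simp: t_def)
    have "norm (of_real (1 - t) * u) \<le> norm u"
      using t by (simp add: norm_mult mult_left_le_one_le del: of_real_diff)
    with u umin[of "of_real (1 - t) * u"] d(2)[OF t(1,2)] show False by simp
  qed
qed


subsection \<open>The image of the disc and its boundary\<close>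

text \<open>A logharmonic f is in general not analytic, so openness comes from invariance of domain
  rather than from the open mapping theorem.\<close>

lemma open_image_disc:
  fixes f :: "complex \<Rightarrow> complex"
  assumes "continuous_on (ball 0 1) f" "inj_on f (ball 0 1)" "A \<subseteq> ball 0 1" "open A"
  shows "open (f ` A)"
  using assms by (intro invariance_of_domain) (auto intro: continuous_on_subset inj_on_subset)

text \<open>Excludes an empty frontier, to which \<open>infdist\<close> is 0 by convention. If f
  were onto, its inverse would send the closed unit disc to a compact subset of the disc, whereas
  \<open>bdd\<close> gives points of modulus arbitrarily near 1 with value in the closed unit
  disc.\<close>

lemma image_disc_ne_UNIV:
  fixes f :: "complex \<Rightarrow> complex"
  assumes cont: "continuous_on (ball 0 1) f" and inj: "inj_on f (ball 0 1)"
    and bdd: "\<And>r. 0 < r \<Longrightarrow> r < 1 \<Longrightarrow> \<exists>z. norm z = r \<and> norm (f z) \<le> 1"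
  shows "f ` ball 0 1 \<noteq> UNIV"
proof
  assume UNIV: "f ` ball 0 1 = UNIV"
  obtain g where g: "homeomorphism (ball 0 1) (f ` ball 0 1) f g"
    using invariance_of_domain_homeomorphism[OF open_ball cont _ inj] by auto
  then have "continuous_on UNIV g" and gf: "\<And>z. z \<in> ball 0 1 \<Longrightarrow> g (f z) = z"
    and gim: "g ` UNIV = ball 0 1"
    unfolding homeomorphism_def UNIV by auto
  then have "compact (g ` cball 0 1)"
    by (intro compact_continuous_image) (auto intro: continuous_on_subset)
  then obtain v where v: "v \<in> g ` cball 0 1" and vmax: "\<And>u. u \<in> g ` cball 0 1 \<Longrightarrow> norm u \<le> norm v"
    using continuous_attains_sup[of "g ` cball 0 1" norm] by (auto intro: continuous_intros)
  have v1: "norm v < 1" using v gim by (metis UNIV_I dist_0_norm image_iff mem_ball)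
  obtain z where z: "norm z = (norm v + 1) / 2" "norm (f z) \<le> 1"
    using bdd[of "(norm v + 1) / 2"] v1 by (auto simp: add_nonneg_pos)
  then have "g (f z) = z" using v1 by (intro gf) auto
  then have "z \<in> g ` cball 0 1" using z(2) by (metis image_eqI mem_cball_0)
  from vmax[OF this] z(1) v1 show False by simp
qed

text \<open>A frontier point lies outside the open image, hence outside the compact image of each
  smaller closed disc of radius \<rho>. It is thus a limit of values on the remaining annulus, where
  |f| \<ge> \<rho> m; then \<rho> tends to 1.\<close>

lemma le_infdist_frontier_image_disc:
  fixes f :: "complex \<Rightarrow> complex"
  assumes cont: "continuous_on (ball 0 1) f" and inj: "inj_on f (ball 0 1)"
    and ne: "f ` ball 0 1 \<noteq> UNIV"
    and growth: "\<And>z. norm z < 1 \<Longrightarrow> norm z * m \<le> norm (f z)" and m: "0 \<le> m"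
  shows "m \<le> infdist 0 (frontier (f ` ball 0 1))"
proof -
  have ne': "frontier (f ` ball 0 1) \<noteq> {}"
    using frontier_eq_empty[of "f ` ball 0 1"] ne by auto
  have "m \<le> dist 0 y" if y: "y \<in> frontier (f ` ball 0 1)" for y
  proof -
    have op: "open (f ` ball 0 1)" by (rule open_image_disc[OF cont inj]) auto
    have y1: "y \<notin> f ` ball 0 1" and y2: "y \<in> closure (f ` ball 0 1)"
      using y op by (auto simp: frontier_def interior_open)
    have "\<rho> * m \<le> norm y" if \<rho>: "0 < \<rho>" "\<rho> < 1" for \<rho>
    proof -
      have "closed (f ` cball 0 \<rho>)"
        using \<rho> by (intro compact_imp_closed compact_continuous_image continuous_on_subset[OF cont]) auto
      moreover have "ball 0 1 = cball 0 \<rho> \<union> (ball (0::complex) 1 - cball 0 \<rho>)" using \<rho> by auto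
      ultimately have "closure (f ` ball 0 1) \<subseteq> f ` cball 0 \<rho> \<union> closure (f ` (ball 0 1 - cball 0 \<rho>))"
        by (metis closure_Un closure_closed image_Un order_refl)
      moreover have "y \<notin> f ` cball 0 \<rho>" using y1 \<rho> by auto
      ultimately have "y \<in> closure (f ` (ball 0 1 - cball 0 \<rho>))" using y2 by auto
      moreover have "f ` (ball 0 1 - cball 0 \<rho>) \<subseteq> {u. \<rho> * m \<le> norm u}"
      proof clarsimp
        fix z :: complex assume z: "norm z < 1" "\<not> norm z \<le> \<rho>"
        have "\<rho> * m \<le> norm z * m" using z m by (intro mult_right_mono) auto
        with growth[OF z(1)] show "\<rho> * m \<le> norm (f z)" by simp
      qed
      moreover have "closed {u::complex. \<rho> * m \<le> norm u}"
        by (intro closed_Collect_le continuous_intros)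
      ultimately show ?thesis by (metis (mono_tags, lifting) closure_minimal in_mono mem_Collect_eq)
    qed
    then have "\<forall>\<^sub>F \<rho> in at_left 1. \<rho> * m \<le> norm y"
      by (intro eventually_at_leftI[of 0]) auto
    moreover have "((\<lambda>\<rho>. \<rho> * m) \<longlongrightarrow> 1 * m) (at_left 1)"
      by (intro tendsto_intros)
    ultimately have "1 * m \<le> norm y"
      by (intro tendsto_upperbound) auto
    then show ?thesis by simp
  qed
  then show ?thesis unfolding infdist_def using ne' by (auto intro!: cINF_greatest)
qed

text \<open>If the limit were a value f(z), the open image of a disc of radius r with |z| < r < 1
  would contain f(t u) for t near 1, against injectivity once t > r.\<close>

lemma radial_limit_in_frontier_image_disc:
  fixes f :: "complex \<Rightarrow> complex"
  assumes cont: "continuous_on (ball 0 1) f" and inj: "inj_on f (ball 0 1)" and u: "norm u = 1"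
    and lim: "((\<lambda>t. f (of_real t * u)) \<longlongrightarrow> y) (at_left (1::real))"
  shows "y \<in> frontier (f ` ball 0 1)"
proof -
  have op: "open (f ` ball 0 1)" by (rule open_image_disc[OF cont inj]) auto
  have ev: "\<forall>\<^sub>F t in at_left (1::real). 0 < t \<and> t < 1"
    by (rule eventually_at_leftI[of 0]) auto
  have "\<forall>\<^sub>F t in at_left (1::real). f (of_real t * u) \<in> f ` ball 0 1"
    using ev by eventually_elim (use u in \<open>auto simp: norm_mult\<close>)
  then have "\<forall>\<^sub>F t in at_left (1::real). f (of_real t * u) \<in> closure (f ` ball 0 1)"
    by (rule eventually_mono) (rule subsetD[OF closure_subset])
  then have "y \<in> closure (f ` ball 0 1)"
    by (rule Lim_in_closed_set[OF closed_closure _ _ lim]) simp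
  moreover have "y \<notin> f ` ball 0 1"
  proof
    assume "y \<in> f ` ball 0 1"
    then obtain z where z: "norm z < 1" "y = f z" by auto
    define r where "r = (norm z + 1) / 2"
    have r: "norm z < r" "r < 1" using z by (auto simp: r_def)
    have "open (f ` ball 0 r)" by (rule open_image_disc[OF cont inj]) (use r in auto)
    moreover have "y \<in> f ` ball 0 r" using z r by auto
    ultimately have "\<forall>\<^sub>F t in at_left (1::real). f (of_real t * u) \<in> f ` ball 0 r"
      using lim topological_tendstoD by blast
    moreover have "\<forall>\<^sub>F t in at_left (1::real). r < t"
      using r by (auto intro: eventually_at_leftI[of r])
    ultimately have "\<forall>\<^sub>F t in at_left (1::real). False" using ev
    proof eventually_elim
      case (elim t)
      then obtain v where v: "norm v < r" "f (of_real t * u) = f v" by auto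
      have "of_real t * u = v"
        by (rule inj_onD[OF inj v(2)]) (use elim v r u in \<open>auto simp: norm_mult\<close>)
      then show False using v elim u by (auto simp: norm_mult)
    qed
    then show False by simp
  qed
  ultimately show ?thesis using op by (simp add: frontier_def interior_open)
qed

text \<open>The maximum principle for exp (-F). Applied to L, it supplies the points needed in
  \<open>image_disc_ne_UNIV\<close>.\<close>

lemma Re_le_value_at_center:
  fixes F :: "complex \<Rightarrow> complex"
  assumes "F holomorphic_on ball 0 1" "0 < r" "r < 1"
  shows "\<exists>z. norm z = r \<and> Re (F z) \<le> Re (F 0)"
proof (rule ccontr)
  assume neg: "\<not> ?thesis"
  define G where "G z = exp (- F z)" for z
  have holG: "G holomorphic_on ball 0 1"
    unfolding G_def by (intro holomorphic_intros assms)
  have sub: "cball 0 r \<subseteq> ball (0::complex) 1" using assms by auto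
  have contG: "continuous_on (cball 0 r) G"
    using holG sub by (meson continuous_on_subset holomorphic_on_imp_continuous_on)
  have "continuous_on (sphere 0 r) (\<lambda>v. norm (G v))"
    by (intro continuous_on_norm continuous_on_subset[OF contG]) auto
  moreover have "of_real r \<in> sphere (0::complex) r" using assms by simp
  ultimately obtain z where z: "norm z = r" and zmax: "\<And>v. norm v = r \<Longrightarrow> norm (G v) \<le> norm (G z)"
    using continuous_attains_sup[of "sphere 0 r" "\<lambda>v. norm (G v)"] by (metis compact_sphere
      empty_iff mem_sphere_0)
  have "norm (G 0) \<le> norm (G z)"
  proof (rule maximum_modulus_frontier[where S = "cball 0 r" and f = G])
    show "G holomorphic_on interior (cball 0 r)"
      using holG sub by (rule_tac holomorphic_on_subset) (auto simp: interior_cball)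
  qed (use assms contG zmax in \<open>auto\<close>)
  then have "Re (F z) \<le> Re (F 0)" unfolding G_def norm_exp_eq_Re by simp
  with neg z show False by blast
qed


subsection \<open>Wirtinger derivatives in terms of the logarithms\<close>

lemma wirtinger_derivatives:
  assumes "(f has_derivative (\<lambda>v. A * v + B * cnj v)) (at z)"
  shows "deriv_z f z = A" "deriv_zbar f z = B"
proof -
  have F: "frechet_derivative f (at z) = (\<lambda>v. A * v + B * cnj v)"
    using frechet_derivative_at[OF assms] by simp
  show "deriv_z f z = A" "deriv_zbar f z = B"
    unfolding deriv_z_def deriv_zbar_def F by (simp_all add: algebra_simps)
qed

text \<open>With h and g exponentials of functions of w = z^k, logarithmic differentiation gives X
  and Y that depend on w alone. The factors z and \<open>cnj z\<close> keep the formulas valid at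
  the origin.\<close>

lemma exp_gap_wirtinger:
  fixes LA LB :: "complex \<Rightarrow> complex"
  assumes k: "k \<ge> 1" and LA: "LA holomorphic_on ball 0 1" and LB: "LB holomorphic_on ball 0 1"
    and form: "\<forall>z\<in>ball 0 1. f z = z * exp (LA (z ^ k)) * cnj (exp (LB (z ^ k)))"
    and z: "norm z < 1"
  defines "X \<equiv> 1 + of_nat k * (z ^ k * deriv LA (z ^ k))"
    and "Y \<equiv> of_nat k * (z ^ k * deriv LB (z ^ k))"
  shows "f differentiable (at z)"
    and "z * deriv_z f z = f z * X" and "cnj z * deriv_zbar f z = f z * cnj Y"
proof -
  have f: "f z = z * exp (LA (z ^ k)) * cnj (exp (LB (z ^ k)))" if "norm z < 1" for z
    using form that by simp
  have wk: "norm (z ^ k) < 1" using z k by (simp add: norm_power power_less_one_iff)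
  have DA: "((\<lambda>z. exp (LA (z ^ k))) has_field_derivative
      exp (LA (z ^ k)) * (deriv LA (z ^ k) * (of_nat k * z ^ (k - 1)))) (at z)"
    by (rule DERIV_chain2[where f = exp], simp, rule DERIV_chain2[where f = LA])
       (use holomorphic_derivI[OF LA, of "z ^ k"] wk in \<open>auto intro!: derivative_eq_intros\<close>)
  have DB: "((\<lambda>z. exp (LB (z ^ k))) has_field_derivative
      exp (LB (z ^ k)) * (deriv LB (z ^ k) * (of_nat k * z ^ (k - 1)))) (at z)"
    by (rule DERIV_chain2[where f = exp], simp, rule DERIV_chain2[where f = LB])
       (use holomorphic_derivI[OF LB, of "z ^ k"] wk in \<open>auto intro!: derivative_eq_intros\<close>)
  define A where "A = exp (LA (z ^ k)) * X * cnj (exp (LB (z ^ k)))"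
  define B where "B = z * exp (LA (z ^ k)) *
    cnj (exp (LB (z ^ k)) * (deriv LB (z ^ k) * (of_nat k * z ^ (k - 1))))"
  have zk: "z * z ^ (k - 1) = z ^ k" using k by (cases k) auto
  have "((\<lambda>z. z * exp (LA (z ^ k)) * cnj (exp (LB (z ^ k)))) has_derivative
      (\<lambda>v. A * v + B * cnj v)) (at z)"
  proof -
    note DA' = DA[unfolded has_field_derivative_def]
    note DB' = has_derivative_cnj[OF DB[unfolded has_field_derivative_def]]
    show ?thesis
      by (rule has_derivative_eq_rhs[OF has_derivative_mult[OF has_derivative_mult[OF has_derivative_ident DA'] DB']])
         (auto simp: fun_eq_iff A_def B_def X_def algebra_simps simp flip: zk)
  qed
  moreover have "eventually (\<lambda>z. z \<in> ball 0 1) (nhds z)"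
    using z by (intro eventually_nhds_in_open) auto
  then have "\<forall>\<^sub>F z in nhds z. z * exp (LA (z ^ k)) * cnj (exp (LB (z ^ k))) = f z"
    by eventually_elim (simp add: f)
  ultimately have D: "(f has_derivative (\<lambda>v. A * v + B * cnj v)) (at z)"
    by (rule_tac has_derivative_transform_eventually) 
       (use z f in \<open>auto simp: eventually_at_filter elim: eventually_mono\<close>)
  then show "f differentiable (at z)" by (auto simp: differentiable_def)
  show "z * deriv_z f z = f z * X" "cnj z * deriv_zbar f z = f z * cnj Y"
    unfolding wirtinger_derivatives[OF D] f[OF z] A_def B_def Y_def zk[symmetric]
    by (simp_all add: algebra_simps)
qed

text \<open>The conjugate on Y does not affect the real part, so starlikeness becomes the condition
  Re (X - Y) > \<alpha> on an analytic function.\<close>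

lemma exp_gap_quotients:
  fixes LA LB :: "complex \<Rightarrow> complex"
  assumes k: "k \<ge> 1" and LA: "LA holomorphic_on ball 0 1" and LB: "LB holomorphic_on ball 0 1"
    and form: "\<forall>z\<in>ball 0 1. f z = z * exp (LA (z ^ k)) * cnj (exp (LB (z ^ k)))"
    and z: "norm z < 1" "z \<noteq> 0"
  defines "X \<equiv> 1 + of_nat k * (z ^ k * deriv LA (z ^ k))"
    and "Y \<equiv> of_nat k * (z ^ k * deriv LB (z ^ k))"
  shows "f z \<noteq> 0" and "starlike_quotient f z = X - cnj Y"
    and "cnj (deriv_zbar f z) / cnj (f z) = \<omega> * (deriv_z f z / f z) \<longleftrightarrow> Y = \<omega> * X"
proof -
  note W = exp_gap_wirtinger[OF k LA LB form z(1), folded X_def Y_def]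
  show fz: "f z \<noteq> 0" using form z by simp
  show "starlike_quotient f z = X - cnj Y"
    unfolding starlike_quotient_def W(2,3) using fz by (simp add: field_simps)
  have "cnj (cnj z * deriv_zbar f z) = cnj (f z * cnj Y)" using W(3) by simp
  then have "z * cnj (deriv_zbar f z) = cnj (f z) * Y" by simp
  then have 1: "cnj (deriv_zbar f z) / cnj (f z) = Y / z" using fz z by (simp add: field_simps)
  have 2: "deriv_z f z / f z = X / z" using fz z W(2) by (simp add: field_simps)
  show "cnj (deriv_zbar f z) / cnj (f z) = \<omega> * (deriv_z f z / f z) \<longleftrightarrow> Y = \<omega> * X"
    unfolding 1 2 using z by simp
qed

section \<open>Logarithms of h and g as power series in w\<close>

lemma powser_scaled_derivative:
  fixes c :: "nat \<Rightarrow> complex"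
  assumes "\<And>w. norm w < 1 \<Longrightarrow> (\<lambda>n. c n * w ^ n) sums q w" and w: "norm w < 1"
  shows "(\<lambda>n. of_nat n * c n * w ^ n) sums (w * deriv q w)"
proof -
  have "(q has_field_derivative deriv q w) (at w)"
    using holomorphic_derivI[OF holomorphic_on_powser[OF assms(1)], of w] w by simp
  then have "(\<lambda>n. diffs c n * w ^ n) sums deriv q w"
    by (intro termdiffs_sums_strong[OF assms(1) _ w]) auto
  from sums_mult[OF this, of w]
  have "(\<lambda>n. of_nat (Suc n) * c (Suc n) * w ^ Suc n) sums (w * deriv q w)"
    by (simp add: diffs_def algebra_simps)
  then show ?thesis by (subst (asm) sums_Suc_iff) simp
qed

text \<open>Every w in the disc is some z^k, so convergence of the gap series for all z makes L a
  power series in w on the whole disc, with constant term 0.\<close>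

lemma exp_gap_seriesE:
  assumes "exp_gap_series k a h" and k: "k \<ge> 1"
  obtains L where "\<And>w. norm w < 1 \<Longrightarrow> (\<lambda>n. (if n = 0 then 0 else a (n * k)) * w ^ n) sums L w"
    "\<And>z. norm z < 1 \<Longrightarrow> h z = exp (L (z ^ k))"
proof
  define L where "L w = (\<Sum>n. a (Suc n * k) * w ^ Suc n)" for w
  show "h z = exp (L (z ^ k))" if "norm z < 1" for z
  proof -
    have "(z ^ k) ^ Suc n = z ^ (Suc n * k)" for n
      by (metis mult.commute power_mult)
    then show ?thesis using assms that unfolding exp_gap_series_def L_def by simp
  qed
  show "(\<lambda>n. (if n = 0 then 0 else a (n * k)) * w ^ n) sums L w" if w: "norm w < 1" for w
  proof -
    obtain z where z: "z ^ k = w" using k exists_complex_root[of k w] by auto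
    have "norm z < 1"
      using w k unfolding z[symmetric] norm_power by (metis norm_ge_zero not_le one_le_power)
    then have "summable (\<lambda>n. a (Suc n * k) * z ^ (Suc n * k))"
      using assms unfolding exp_gap_series_def by simp
    moreover have "z ^ (Suc n * k) = w ^ Suc n" for n
      unfolding z[symmetric] by (metis mult.commute power_mult)
    ultimately have "(\<lambda>n. a (Suc n * k) * w ^ Suc n) sums L w"
      unfolding L_def by (simp add: summable_sums)
    then have "(\<lambda>n. (\<lambda>n. (if n = 0 then 0 else a (n * k)) * w ^ n) (Suc n)) sums L w" by simp
    then show ?thesis by (subst (asm) sums_Suc_iff) simp
  qed
qed

text \<open>The n-th Taylor coefficients of X and Y are k n times those of log h and log g, whence
  the division by k n. The distance bound is the growth bound with the radius in the exponent pushed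
  to 1.\<close>

lemma S_LH_bounds:
  assumes k: "k \<ge> 1" and \<alpha>: "0 \<le> \<alpha>" "\<alpha> < 1"
    and f: "f \<in> S_LH k \<alpha>" "logharmonic_form k a b h g f" "logharmonic_with \<omega> f"
  shows "norm (a (Suc n * k)) \<le> (2 * (1 - \<alpha>) + 1 / real (Suc n)) / real k"
    and "norm (b (Suc n * k)) \<le> (2 * (1 - \<alpha>) + (2 * \<alpha> - 1) / real (Suc n)) / real k"
    and "exp (growth_exponent \<alpha> 1 / real k) \<le> infdist (f 0) (frontier (f ` ball 0 1))"
proof -
  have gap: "exp_gap_series k a h" "exp_gap_series k b g" and form: "\<And>z. z \<in> ball 0 1 \<Longrightarrow> f z = z * h z * cnj (g z)"
    using f(2) by (auto simp: logharmonic_form_def)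
  obtain LA where LA: "\<And>w. norm w < 1 \<Longrightarrow> (\<lambda>n. (if n = 0 then 0 else a (n * k)) * w ^ n) sums LA w"
    and hLA: "\<And>z. norm z < 1 \<Longrightarrow> h z = exp (LA (z ^ k))"
    using exp_gap_seriesE[OF gap(1) k] by blast
  obtain LB where LB: "\<And>w. norm w < 1 \<Longrightarrow> (\<lambda>n. (if n = 0 then 0 else b (n * k)) * w ^ n) sums LB w"
    and gLB: "\<And>z. norm z < 1 \<Longrightarrow> g z = exp (LB (z ^ k))"
    using exp_gap_seriesE[OF gap(2) k] by blast
  have holA: "LA holomorphic_on ball 0 1" and holB: "LB holomorphic_on ball 0 1"
    using holomorphic_on_powser[OF LA] holomorphic_on_powser[OF LB] by auto
  have LA0: "LA 0 = 0" and LB0: "LB 0 = 0" using powser_at_0[OF LA] powser_at_0[OF LB] by auto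
  have fL: "f z = z * exp (LA (z ^ k)) * cnj (exp (LB (z ^ k)))" if "norm z < 1" for z
    using that form[of z] hLA gLB by simp
  then have formL: "\<forall>z\<in>ball 0 1. f z = z * exp (LA (z ^ k)) * cnj (exp (LB (z ^ k)))" by simp
  define x where "x n = (if n = 0 then 1 else of_nat k * of_nat n * a (n * k))" for n
  define y where "y n = (if n = 0 then 0 else of_nat k * of_nat n * b (n * k))" for n
  define X where "X w = 1 + of_nat k * (w * deriv LA w)" for w
  define Y where "Y w = of_nat k * (w * deriv LB w)" for w
  have X: "(\<lambda>n. x n * w ^ n) sums X w" if w: "norm w < 1" for w
  proof -
    have "(\<lambda>n. if n = 0 then 1 else 0) sums (1::complex)"
      using sums_If_finite[of "\<lambda>n. n = 0" "\<lambda>n. 1::complex"] by simp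
    from sums_add[OF this sums_mult[OF powser_scaled_derivative[OF LA w], of "of_nat k"]]
    have "(\<lambda>n. (if n = 0 then 1 else 0) + of_nat k * (of_nat n * (if n = 0 then 0 else a (n * k)) * w ^ n)) sums X w"
      by (simp only: X_def)
    then show ?thesis by (rule back_subst[of "\<lambda>f. f sums X w"]) (auto simp: x_def fun_eq_iff)
  qed
  have Y: "(\<lambda>n. y n * w ^ n) sums Y w" if w: "norm w < 1" for w
  proof -
    from sums_mult[OF powser_scaled_derivative[OF LB w], of "of_nat k"]
    have "(\<lambda>n. of_nat k * (of_nat n * (if n = 0 then 0 else b (n * k)) * w ^ n)) sums Y w"
      by (simp only: Y_def)
    then show ?thesis by (rule back_subst[of "\<lambda>f. f sums Y w"]) (auto simp: y_def fun_eq_iff)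
  qed
  have X0: "X 0 = 1" and Y0: "Y 0 = 0" by (auto simp: X_def Y_def)
  have pt: "norm (Y w) < norm (X w) \<and> \<alpha> < Re (X w - Y w)" if w: "norm w < 1" for w
  proof (cases "w = 0")
    case True
    then show ?thesis using X0 Y0 \<alpha> by simp
  next
    case False
    \<comment> \<open>Any root serves: X and Y depend on w only, and of the dilatation only its
      bound at that root is used.\<close>
    obtain z where z: "z ^ k = w" using k exists_complex_root[of k w] by auto
    have z1: "norm z < 1"
      using w k unfolding z[symmetric] norm_power by (metis norm_ge_zero not_le one_le_power)
    have z0: "z \<noteq> 0" using False z k by auto
    note Q = exp_gap_quotients[OF k holA holB formL z1 z0, unfolded z, folded X_def Y_def]
    have "starlike_of_order \<alpha> f" using f(1) by (auto simp: S_LH_def)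
    then have "Re (starlike_quotient f z) > \<alpha>"
      using z1 z0 by (auto simp: starlike_of_order_def)
    then have re: "\<alpha> < Re (X w - Y w)" unfolding Q(2) by simp
    have "Y w = \<omega> z * X w" and om: "norm (\<omega> z) < 1"
      using f(3) Q(1) z1 Q(3)[of "\<omega> z"] by (auto simp: logharmonic_with_def)
    \<comment> \<open>If X vanished at w, so would Y, contradicting Re (X - Y) > \<alpha> \<ge> 0.
      This makes |\<omega> X| < |X| strict.\<close>
    moreover have "X w \<noteq> 0"
      using re \<alpha> \<open>Y w = \<omega> z * X w\<close> by auto
    ultimately show ?thesis using re by (simp add: norm_mult)
  qed
  have "norm (x (Suc n)) \<le> 2 * (1 - \<alpha>) * real (Suc n) + 1"
    by (rule starlike_coeff_bounds(1)[OF X Y _ _ \<alpha>]) (use pt in \<open>auto simp: x_def y_def\<close>)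
  moreover have "norm (x (Suc n)) = real k * real (Suc n) * norm (a (Suc n * k))"
    by (simp only: x_def nat.distinct if_False norm_mult norm_of_nat)
  ultimately show "norm (a (Suc n * k)) \<le> (2 * (1 - \<alpha>) + 1 / real (Suc n)) / real k"
    using k by (simp add: field_simps del: of_nat_Suc)
  have "norm (y (Suc n)) \<le> 2 * (1 - \<alpha>) * real n + 1"
    by (rule starlike_coeff_bounds(2)[OF X Y _ _ \<alpha>]) (use pt in \<open>auto simp: x_def y_def\<close>)
  moreover have "norm (y (Suc n)) = real k * real (Suc n) * norm (b (Suc n * k))"
    by (simp only: y_def nat.distinct if_False norm_mult norm_of_nat)
  \<comment> \<open>The bound at index \<open>Suc n\<close> has only n full terms; written with
    \<open>Suc n\<close>, its constant becomes 1 - 2(1 - \<alpha>) = 2\<alpha> - 1.\<close>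
  moreover have "2 * (1 - \<alpha>) * real n + 1 = 2 * (1 - \<alpha>) * real (Suc n) + (2 * \<alpha> - 1)"
    by (simp add: algebra_simps)
  ultimately show "norm (b (Suc n * k)) \<le> (2 * (1 - \<alpha>) + (2 * \<alpha> - 1) / real (Suc n)) / real k"
    using k by (simp add: field_simps del: of_nat_Suc)
  \<comment> \<open>Conjugation preserves the modulus, so the logarithms add up: |f(z)| = |z| exp
    (Re L(z^k) / k).\<close>
  define L where "L w = of_nat k * (LA w + LB w)" for w
  have holL: "L holomorphic_on ball 0 1" unfolding L_def by (intro holomorphic_intros holA holB)
  have L0: "L 0 = 0" by (simp add: L_def LA0 LB0)
  have growthL: "growth_exponent \<alpha> (norm w) \<le> Re (L w)" if w: "norm w < 1" for w
  proof (rule logharmonic_growth[where X = X and Y = Y])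
    show "u * deriv L u = X u + Y u - 1" if "norm u < 1" for u
    proof -
      have "(L has_field_derivative of_nat k * (deriv LA u + deriv LB u)) (at u)"
        unfolding L_def using holomorphic_derivI[OF holA, of u] holomorphic_derivI[OF holB, of u] that
        by (auto intro!: derivative_eq_intros)
      then show ?thesis by (simp add: DERIV_imp_deriv X_def Y_def algebra_simps)
    qed
  qed (use pt X0 Y0 L0 w \<alpha> holL holomorphic_on_powser[OF X] holomorphic_on_powser[OF Y] in auto)
  have normf: "norm (f z) = norm z * exp (Re (L (z ^ k)) / real k)" if "norm z < 1" for z
    using k by (simp add: fL[OF that] norm_mult L_def mult.assoc exp_add[symmetric])
  have growth: "norm z * exp (growth_exponent \<alpha> (norm z ^ k) / real k) \<le> norm (f z)" if z: "norm z < 1" for z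
  proof -
    have "norm (z ^ k) < 1" using z k by (simp add: norm_power power_less_one_iff)
    from growthL[OF this] show ?thesis
      unfolding normf[OF z] by (intro mult_left_mono) (auto simp: norm_power intro!: divide_right_mono)
  qed
  have cont: "continuous_on (ball 0 1) f"
    using exp_gap_wirtinger(1)[OF k holA holB formL] 
    by (intro differentiable_imp_continuous_on) (auto simp: differentiable_on_def intro: differentiable_at_withinI)
  have inj: "inj_on f (ball 0 1)" using f(1) by (auto simp: S_LH_def)
  have f0: "f 0 = 0" using fL[of 0] by simp
  have "f ` ball 0 1 \<noteq> UNIV"
  proof (rule image_disc_ne_UNIV[OF cont inj])
    fix r :: real assume r: "0 < r" "r < 1"
    have "0 < r ^ k" "r ^ k < 1" using r k by (auto simp: power_less_one_iff)
    then obtain w where w: "norm w = r ^ k" "Re (L w) \<le> Re (L 0)"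
      using Re_le_value_at_center[OF holL, of "r ^ k"] by auto
    obtain z where z: "z ^ k = w" using k exists_complex_root[of k w] by auto
    have "norm z ^ k = r ^ k" using w(1) z by (metis norm_power)
    then have nz: "norm z = r" using r k by (simp add: power_eq_iff_eq_base)
    have "norm (f z) = r * exp (Re (L w) / real k)" using normf[of z] r nz z by simp
    also have "\<dots> \<le> 1 * 1"
      using w(2) r by (intro mult_mono) (auto simp: L0 divide_nonpos_nonneg)
    finally show "\<exists>z. norm z = r \<and> norm (f z) \<le> 1" using nz by auto
  qed
  then show "exp (growth_exponent \<alpha> 1 / real k) \<le> infdist (f 0) (frontier (f ` ball 0 1))"
    unfolding f0
  proof (rule le_infdist_frontier_image_disc[OF cont inj])
    fix z :: complex assume z: "norm z < 1"
    have "growth_exponent \<alpha> 1 \<le> growth_exponent \<alpha> (norm z ^ k)"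
      using z \<alpha> by (intro growth_exponent_antimono) (auto simp: power_le_one)
    then have "norm z * exp (growth_exponent \<alpha> 1 / real k) \<le> norm z * exp (growth_exponent \<alpha> (norm z ^ k) / real k)"
      by (intro mult_left_mono) (auto intro!: divide_right_mono)
    also note growth[OF z]
    finally show "norm z * exp (growth_exponent \<alpha> 1 / real k) \<le> norm (f z)" .
  qed simp
qed


subsection \<open>Univalence on a half-plane\<close>

text \<open>The variable \<open>\<eta>\<close> is the logarithm of a point of the disc. Fix \<open>r < 0\<close>. By compactness there is a last
  point of the leftward segment from \<open>y\<close> that is attained by \<open>\<Phi>\<close> on \<open>Re \<eta> \<le> r\<close>. The inverse of \<open>\<Phi>\<close> decreases
  \<open>Re \<eta>\<close> to the left, so beyond that point there would be further ones unless the segment ends there.\<close>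

lemma half_plane_image_leftward:
  fixes \<Phi> :: "complex \<Rightarrow> complex"
  defines "H \<equiv> {\<eta>. Re \<eta> < 0}"
  assumes hol: "\<Phi> holomorphic_on H" and inj: "inj_on \<Phi> H"
    and pos: "\<And>\<eta>. \<eta> \<in> H \<Longrightarrow> 0 < Re (deriv \<Phi> \<eta>)"
    and bdd: "\<And>s. s < 0 \<Longrightarrow> \<exists>M. \<forall>\<eta>. Re \<eta> \<le> s \<longrightarrow> norm (\<Phi> \<eta> - \<eta>) \<le> M"
    and y: "y \<in> \<Phi> ` H" and s: "0 \<le> s"
  shows "y - of_real s \<in> \<Phi> ` H"
proof -
  have opH: "open H" unfolding H_def by (rule open_halfspace_Re_lt)
  obtain \<eta>0 where \<eta>0: "\<eta>0 \<in> H" "y = \<Phi> \<eta>0" using y by auto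
  define r where "r = Re \<eta>0"
  have r: "r < 0" using \<eta>0 by (simp add: r_def H_def)
  obtain M where M: "\<And>\<eta>. Re \<eta> \<le> r \<Longrightarrow> norm (\<Phi> \<eta> - \<eta>) \<le> M" using bdd[OF r] by auto
  \<comment> \<open>\<Phi> differs from the identity by at most M on Re \<eta> \<le> r, so all
    preimages there of points of the segment have modulus at most R.\<close>
  define R where "R = norm y + s + M"
  define K where "K = {\<eta>. Re \<eta> \<le> r} \<inter> cball 0 R"
  have KH: "K \<subseteq> H" using r by (auto simp: K_def H_def)
  have "compact K" unfolding K_def
    by (intro closed_Int_compact closed_halfspace_Re_le compact_cball)
  moreover have "continuous_on K \<Phi>"
    using hol KH by (meson continuous_on_subset holomorphic_on_imp_continuous_on)
  ultimately have cK: "compact (\<Phi> ` K)" by (rule compact_continuous_image[rotated])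
  have inK: "\<eta> \<in> K" if "Re \<eta> \<le> r" "\<Phi> \<eta> = y - of_real t" "0 \<le> t" "t \<le> s" for \<eta> t
  proof -
    have "norm \<eta> \<le> norm (\<Phi> \<eta>) + norm (\<Phi> \<eta> - \<eta>)"
      using norm_triangle_ineq4[of "\<Phi> \<eta>" "\<Phi> \<eta> - \<eta>"] by simp
    also have "\<dots> \<le> (norm y + s) + M"
      using that norm_triangle_ineq4[of y "of_real t"] by (intro add_mono M) auto
    finally show ?thesis using that by (simp add: K_def R_def)
  qed
  define S where "S = {t. 0 \<le> t \<and> t \<le> s \<and> y - of_real t \<in> \<Phi> ` K}"
  have "S = {0..s} \<inter> (\<lambda>t. y - of_real t) -` (\<Phi> ` K)" by (auto simp: S_def)
  moreover have "closed ((\<lambda>t::real. y - of_real t) -` (\<Phi> ` K))"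
    using cK by (intro continuous_closed_vimage compact_imp_closed) (auto intro!: continuous_intros)
  ultimately have "compact S" by (simp add: compact_Int_closed)
  moreover have "0 \<in> S"
    using \<eta>0 s inK[of \<eta>0 0] by (auto simp: S_def r_def)
  ultimately obtain t where t: "t \<in> S" and tmax: "\<And>t'. t' \<in> S \<Longrightarrow> t' \<le> t"
    using compact_attains_sup[of S] by auto
  have "t = s"
  proof (rule ccontr)
    assume "t \<noteq> s"
    then have ts: "0 \<le> t" "t < s" using t by (auto simp: S_def)
    obtain \<eta> where \<eta>: "\<eta> \<in> K" "\<Phi> \<eta> = y - of_real t" using t by (force simp: S_def)
    have \<eta>H: "\<eta> \<in> H" and \<eta>r: "Re \<eta> \<le> r" using \<eta> KH by (auto simp: K_def)
    obtain \<Psi> where \<Psi>: "\<Psi> holomorphic_on \<Phi> ` H"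
      and d\<Psi>: "\<And>z. z \<in> H \<Longrightarrow> deriv \<Phi> z * deriv \<Psi> (\<Phi> z) = 1" and inv: "\<And>z. z \<in> H \<Longrightarrow> \<Psi> (\<Phi> z) = z"
      using holomorphic_has_inverse[OF hol opH inj] by metis
    have op: "open (\<Phi> ` H)" by (rule open_mapping_thm3[OF hol opH inj])
    \<comment> \<open>The derivative of the inverse is the reciprocal of that of \<Phi>, again of
      positive real part. Hence moving left in the image lowers the real part of the
      preimage.\<close>
    have "0 < Re (deriv \<Psi> (\<Phi> \<eta>))"
    proof -
      have "deriv \<Phi> \<eta> \<noteq> 0" using pos[OF \<eta>H] by auto
      then have "deriv \<Psi> (\<Phi> \<eta>) = inverse (deriv \<Phi> \<eta>)"
        using d\<Psi>[OF \<eta>H] by (simp add: field_simps)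
      then show ?thesis using pos[OF \<eta>H] \<open>deriv \<Phi> \<eta> \<noteq> 0\<close>
        by (simp add: Re_complex_div_gt_0 inverse_eq_divide)
    qed
    moreover have "((\<lambda>t'. Re (\<Psi> (y - of_real t'))) has_real_derivative - Re (deriv \<Psi> (\<Phi> \<eta>))) (at t)"
    proof -
      have "(\<Psi> has_field_derivative deriv \<Psi> (\<Phi> \<eta>)) (at (y - of_real t))"
        using holomorphic_derivI[OF \<Psi> op imageI[OF \<eta>H]] \<eta>(2) by simp
      then have "((\<lambda>z. \<Psi> (y - z)) has_field_derivative deriv \<Psi> (\<Phi> \<eta>) * (- 1)) (at (of_real t))"
        by (intro DERIV_chain2[where f = \<Psi>]) (auto intro!: derivative_eq_intros)
      from bounded_linear.has_vector_derivative[OF bounded_linear_Re has_vector_derivative_real_field[OF this]]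
      show ?thesis by (simp add: has_real_derivative_iff_has_vector_derivative)
    qed
    ultimately obtain d where d: "d > 0"
      "\<And>e. 0 < e \<Longrightarrow> e < d \<Longrightarrow> Re (\<Psi> (y - of_real (t + e))) < Re (\<Psi> (y - of_real t))"
      using DERIV_neg_dec_right by (metis neg_less_0_iff_less)
    obtain e0 where e0: "e0 > 0" "ball (\<Phi> \<eta>) e0 \<subseteq> \<Phi> ` H"
      using op \<eta>H openE by blast
    \<comment> \<open>Small enough to stay on the segment, within the range where Re \<Psi> has
      decreased, and inside the open image.\<close>
    define e where "e = min (s - t) (min d e0) / 2"
    have e: "0 < e" "e < d" "e < e0" "t + e \<le> s"
      using d(1) e0(1) ts by (auto simp: e_def min_def field_simps)
    have "y - of_real (t + e) \<in> ball (\<Phi> \<eta>) e0"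
      using e \<eta>(2) by (simp add: dist_norm algebra_simps)
    then obtain \<zeta> where \<zeta>: "\<zeta> \<in> H" "\<Phi> \<zeta> = y - of_real (t + e)" using e0(2) by auto
    have "Re \<zeta> < Re \<eta>"
      using d(2)[OF e(1,2)] inv[OF \<zeta>(1)] inv[OF \<eta>H] \<zeta>(2) \<eta>(2) by simp
    then have "\<zeta> \<in> K" using \<eta>r \<zeta>(2) ts e by (intro inK[of _ "t + e"]) auto
    then have "t + e \<in> S" using ts e \<zeta>(2) by (force simp: S_def)
    from tmax[OF this] e(1) show False by simp
  qed
  then have "y - of_real s \<in> \<Phi> ` K" using t by (simp add: S_def)
  then show ?thesis using KH by auto
qed

text \<open>The Noshiro-Warschawski criterion: along the segment from a to b the real part of
  \<Phi>/(b - a) has positive derivative, so the end values differ.\<close>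

lemma inj_on_half_plane_Re_deriv_pos:
  fixes \<Phi> :: "complex \<Rightarrow> complex"
  assumes hol: "\<Phi> holomorphic_on S" and S: "open S" "convex S"
    and pos: "\<And>\<eta>. \<eta> \<in> S \<Longrightarrow> 0 < Re (deriv \<Phi> \<eta>)"
  shows "inj_on \<Phi> S"
proof (rule inj_onI, rule ccontr)
  fix a b assume ab: "a \<in> S" "b \<in> S" "\<Phi> a = \<Phi> b" "a \<noteq> b"
  define u where "u t = Re (\<Phi> (a + of_real t * (b - a)) / (b - a))" for t :: real
  have "u 0 < u 1"
  proof (rule DERIV_pos_imp_increasing[where f = u])
    fix t :: real assume t: "0 \<le> t" "t \<le> 1"
    let ?z = "a + of_real t * (b - a)"
    have z: "?z \<in> S"
      using S(2) ab(1,2) t convexD_alt[of S a b t] by (simp add: scaleR_conv_of_real algebra_simps)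
    have "((\<lambda>z. \<Phi> (a + z * (b - a))) has_field_derivative deriv \<Phi> ?z * (b - a)) (at (of_real t))"
      by (rule DERIV_chain2[where f = \<Phi>])
         (use holomorphic_derivI[OF hol S(1) z] in \<open>auto intro!: derivative_eq_intros\<close>)
    from DERIV_cdivide[OF this, of "b - a"]
    have "((\<lambda>z. \<Phi> (a + z * (b - a)) / (b - a)) has_field_derivative deriv \<Phi> ?z) (at (of_real t))"
      using ab(4) by simp
    from bounded_linear.has_vector_derivative[OF bounded_linear_Re has_vector_derivative_real_field[OF this]]
    show "\<exists>D. (u has_real_derivative D) (at t) \<and> D > 0"
      using pos[OF z] unfolding u_def by (auto simp: has_real_derivative_iff_has_vector_derivative)
  qed simp
  then show False using ab by (simp add: u_def)
qed

text \<open>Equal values force Im \<Phi> to agree at a and b, so \<Phi> a and \<Phi> b lie on a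
  horizontal segment, which stays in the image by \<open>half_plane_image_leftward\<close>. Along
  it, t + 2 Re G has derivative 1 + 2 Re c > 0, because G has derivative c with respect to
  \<Phi>.\<close>

lemma half_plane_starlike_inj:
  fixes \<Phi> G c :: "complex \<Rightarrow> complex"
  defines "H \<equiv> {\<eta>. Re \<eta> < 0}"
  assumes hol: "\<Phi> holomorphic_on H" "G holomorphic_on H"
    and pos: "\<And>\<eta>. \<eta> \<in> H \<Longrightarrow> 0 < Re (deriv \<Phi> \<eta>)"
    and bdd: "\<And>s. s < 0 \<Longrightarrow> \<exists>M. \<forall>\<eta>. Re \<eta> \<le> s \<longrightarrow> norm (\<Phi> \<eta> - \<eta>) \<le> M"
    and dG: "\<And>\<eta>. \<eta> \<in> H \<Longrightarrow> deriv G \<eta> = c \<eta> * deriv \<Phi> \<eta>"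
    and c: "\<And>\<eta>. \<eta> \<in> H \<Longrightarrow> 0 < Re (1 + 2 * c \<eta>)"
  shows "inj_on (\<lambda>\<eta>. \<Phi> \<eta> + of_real (2 * Re (G \<eta>))) H"
proof -
  have opH: "open H" unfolding H_def by (rule open_halfspace_Re_lt)
  have inj: "inj_on \<Phi> H"
    by (rule inj_on_half_plane_Re_deriv_pos[OF hol(1) opH _ pos]) (auto simp: H_def convex_halfspace_Re_lt)
  obtain \<Psi> where \<Psi>: "\<Psi> holomorphic_on \<Phi> ` H"
    and d\<Psi>: "\<And>z. z \<in> H \<Longrightarrow> deriv \<Phi> z * deriv \<Psi> (\<Phi> z) = 1" and inv: "\<And>z. z \<in> H \<Longrightarrow> \<Psi> (\<Phi> z) = z"
    using holomorphic_has_inverse[OF hol(1) opH inj] by metis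
  have op: "open (\<Phi> ` H)" by (rule open_mapping_thm3[OF hol(1) opH inj])
  have eq: "a = b"
    if ab: "a \<in> H" "b \<in> H" "\<Phi> a + of_real (2 * Re (G a)) = \<Phi> b + of_real (2 * Re (G b))"
      and le: "Re (\<Phi> a) \<le> Re (\<Phi> b)" for a b
  proof -
    define s where "s = Re (\<Phi> b) - Re (\<Phi> a)"
    have b: "\<Phi> b = \<Phi> a + of_real s"
      using arg_cong[OF ab(3), of Im] by (simp add: s_def complex_eq_iff)
    define u where "u t = t + 2 * Re (G (\<Psi> (\<Phi> a + of_real t)))" for t
    have "s = 0"
    proof (rule ccontr)
      assume "s \<noteq> 0"
      then have s: "0 < s" using le by (simp add: s_def)
      have "u 0 < u s"
      proof (rule DERIV_pos_imp_increasing[OF s])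
        fix t assume t: "0 \<le> t" "t \<le> s"
        have "\<Phi> b - of_real (s - t) \<in> \<Phi> ` H"
          unfolding H_def
          by (rule half_plane_image_leftward)
             (use hol(1) inj pos bdd ab(2) t in \<open>auto simp: H_def\<close>)
        then obtain \<eta> where \<eta>: "\<eta> \<in> H" "\<Phi> \<eta> = \<Phi> a + of_real t" unfolding b by auto
        have nz: "deriv \<Phi> \<eta> \<noteq> 0" using pos[OF \<eta>(1)] by auto
        have D1: "(G has_field_derivative deriv G \<eta>) (at (\<Psi> (\<Phi> \<eta>)))"
          using holomorphic_derivI[OF hol(2) opH \<eta>(1)] inv[OF \<eta>(1)] by simp
        have D2: "(\<Psi> has_field_derivative deriv \<Psi> (\<Phi> \<eta>)) (at (\<Phi> \<eta>))"
          using holomorphic_derivI[OF \<Psi> op, of "\<Phi> \<eta>"] \<eta>(1) by auto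
        have D3: "((\<lambda>z. \<Psi> (\<Phi> a + z)) has_field_derivative deriv \<Psi> (\<Phi> \<eta>) * 1) (at (of_real t))"
          by (rule DERIV_chain2[where f = \<Psi>]) (use D2 \<eta>(2) in \<open>auto intro!: derivative_eq_intros\<close>)
        have "((\<lambda>z. G (\<Psi> (\<Phi> a + z))) has_field_derivative deriv G \<eta> * (deriv \<Psi> (\<Phi> \<eta>) * 1)) (at (of_real t))"
          by (rule DERIV_chain2[where f = G]) (use D1 D3 \<eta>(2) in auto)
        moreover have "deriv G \<eta> * (deriv \<Psi> (\<Phi> \<eta>) * 1) = c \<eta>"
          using d\<Psi>[OF \<eta>(1)] dG[OF \<eta>(1)] by (simp add: mult.assoc)
        ultimately have "((\<lambda>z. G (\<Psi> (\<Phi> a + z))) has_field_derivative c \<eta>) (at (of_real t))" by simp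
        from bounded_linear.has_vector_derivative[OF bounded_linear_Re has_vector_derivative_real_field[OF this]]
        have "((\<lambda>t. Re (G (\<Psi> (\<Phi> a + of_real t)))) has_real_derivative Re (c \<eta>)) (at t)"
          by (simp add: has_real_derivative_iff_has_vector_derivative)
        then have "(u has_real_derivative 1 + 2 * Re (c \<eta>)) (at t)"
          unfolding u_def by (intro DERIV_add[OF DERIV_ident] DERIV_cmult)
        then show "\<exists>D. (u has_real_derivative D) (at t) \<and> D > 0" using c[OF \<eta>(1)] by auto
      qed
      moreover have "u 0 = u s"
        using arg_cong[OF ab(3), of Re] inv[OF ab(1)] inv[OF ab(2)] b by (simp add: u_def)
      ultimately show False by simp
    qed
    then have "\<Phi> a = \<Phi> b" using b by simp
    then show ?thesis using inj ab by (auto dest: inj_onD)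
  qed
  show ?thesis
  proof (rule inj_onI)
    fix a b assume "a \<in> H" "b \<in> H" "\<Phi> a + of_real (2 * Re (G a)) = \<Phi> b + of_real (2 * Re (G b))"
    then show "a = b" using eq[of a b] eq[of b a] by (cases "Re (\<Phi> a) \<le> Re (\<Phi> b)") auto
  qed
qed


subsection \<open>The extremal function\<close>

text \<open>For \<beta> = 1 and \<beta> = 2\<alpha> - 1 these are k log h and k log g of the
  extremal function, that is, the solutions vanishing at 0 of w L' = X - 1 and w L' = Y with X =
  p/(1 - w) and Y = w p/(1 - w).\<close>

definition koebe_log :: "real \<Rightarrow> real \<Rightarrow> complex \<Rightarrow> complex"
  where "koebe_log \<alpha> \<beta> w = of_real (2 * (1 - \<alpha>)) * (w / (1 - w)) - of_real \<beta> * Ln (1 - w)"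

lemma koebe_log_sums:
  assumes "norm w < 1"
  shows "(\<lambda>n. of_real (2 * (1 - \<alpha>) + \<beta> / real (Suc n)) * w ^ Suc n) sums koebe_log \<alpha> \<beta> w"
proof -
  have "(\<lambda>n. w ^ Suc n) sums (w * (1 / (1 - w)))"
    using sums_mult[OF geometric_sums[OF assms], of w] by simp
  moreover have "(\<lambda>n. - (w ^ n) / of_nat n) sums Ln (1 - w)"
    using Ln_series'[of "- w"] assms by simp
  then have "(\<lambda>n. - (w ^ Suc n) / of_nat (Suc n)) sums Ln (1 - w)"
    by (subst sums_Suc_iff) simp
  ultimately have "(\<lambda>n. of_real (2 * (1 - \<alpha>)) * w ^ Suc n - of_real \<beta> * (- (w ^ Suc n) / of_nat (Suc n)))
      sums (of_real (2 * (1 - \<alpha>)) * (w * (1 / (1 - w))) - of_real \<beta> * Ln (1 - w))"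
    by (intro sums_diff sums_mult)
  moreover have "of_real (2 * (1 - \<alpha>)) * w ^ Suc n - of_real \<beta> * (- (w ^ Suc n) / of_nat (Suc n))
      = of_real (2 * (1 - \<alpha>) + \<beta> / real (Suc n)) * w ^ Suc n" for n
    by (simp add: algebra_simps del: of_nat_Suc power_Suc)
  ultimately show ?thesis by (simp only: koebe_log_def) simp
qed

lemma koebe_log_derivative:
  assumes "norm w < 1"
  shows "(koebe_log \<alpha> \<beta> has_field_derivative
    of_real (2 * (1 - \<alpha>)) / (1 - w)\<^sup>2 + of_real \<beta> / (1 - w)) (at w)"
proof -
  have "w \<noteq> 1" using assms by auto
  moreover have "1 - w \<notin> \<real>\<^sub>\<le>\<^sub>0"
    using assms complex_Re_le_cmod[of w] by (auto simp: complex_nonpos_Reals_iff)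
  ultimately show ?thesis
    unfolding koebe_log_def
    by (auto intro!: derivative_eq_intros simp: power2_eq_square field_simps)
qed

lemma koebe_log_holomorphic: "koebe_log \<alpha> \<beta> holomorphic_on ball 0 1"
proof (rule holomorphic_onI)
  fix w :: complex assume "w \<in> ball 0 1"
  then have "norm w < 1" by simp
  then show "koebe_log \<alpha> \<beta> field_differentiable at w within ball 0 1"
    unfolding field_differentiable_def
    by (blast intro: has_field_derivative_at_within koebe_log_derivative)
qed

lemma koebe_log_of_real:
  assumes "r < 1"
  shows "koebe_log \<alpha> \<beta> (of_real r) = of_real (2 * (1 - \<alpha>) * (r / (1 - r)) - \<beta> * ln (1 - r))"
proof -
  have "Ln (1 - of_real r) = of_real (ln (1 - r))"
    using assms Ln_of_real[of "1 - r"] by simp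
  then show ?thesis by (simp add: koebe_log_def)
qed

lemma Re_half_plane_map:
  assumes "norm w < 1"
  shows "0 < Re (1 + 2 * (w / (1 - w)))"
proof (rule Re_pos_if_norm_less)
  have "w \<noteq> 1" using assms by auto
  then have "1 + w / (1 - w) = 1 / (1 - w)" by (simp add: field_simps)
  then show "norm (w / (1 - w)) < norm (1 + w / (1 - w))"
    using assms \<open>w \<noteq> 1\<close> by (simp add: norm_divide divide_strict_right_mono)
qed

text \<open>The expression is p = (1 + (1 - 2\<alpha>) w)/(1 - w), split so that Re (w/(1 - w)) >
  -1/2 gives the bound.\<close>

lemma Re_starlike_factor:
  assumes "norm w < 1" "\<alpha> < 1"
  shows "\<alpha> < Re (1 + of_real (2 * (1 - \<alpha>)) * (w / (1 - w)))"
proof -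
  define v where "v = w / (1 - w)"
  have "0 < (1 - \<alpha>) * Re (1 + 2 * v)"
    using Re_half_plane_map[OF assms(1)] assms(2) by (simp add: v_def)
  also have "\<dots> = Re (1 + of_real (2 * (1 - \<alpha>)) * v) - \<alpha>"
    by (simp add: algebra_simps)
  finally show ?thesis by (simp add: v_def)
qed

text \<open>The map is k log f in the variable \<eta> = k log z. Replacing \<open>cnj G\<close> by 2
  Re G - G splits it into the analytic part \<Phi> = k log (z h/g) and a real term.\<close>

lemma koebe_log_inj:
  assumes \<alpha>: "0 \<le> \<alpha>" "\<alpha> < 1"
  shows "inj_on (\<lambda>\<eta>. \<eta> + koebe_log \<alpha> 1 (exp \<eta>) + cnj (koebe_log \<alpha> (2 * \<alpha> - 1) (exp \<eta>))) {\<eta>. Re \<eta> < 0}"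
proof -
  define K where "K w = koebe_log \<alpha> 1 w - koebe_log \<alpha> (2 * \<alpha> - 1) w" for w
  define G where "G \<eta> = koebe_log \<alpha> (2 * \<alpha> - 1) (exp \<eta>)" for \<eta>
  define \<Phi> where "\<Phi> \<eta> = \<eta> + K (exp \<eta>)" for \<eta>
  have opH: "open {\<eta>. Re \<eta> < 0}" by (rule open_halfspace_Re_lt)
  have holK: "K holomorphic_on ball 0 1"
    unfolding K_def by (intro holomorphic_intros koebe_log_holomorphic)
  have e1: "norm (exp \<eta>) < 1" if "Re \<eta> < 0" for \<eta> using that by simp
  have D\<Phi>: "(\<Phi> has_field_derivative 1 + of_real (2 * (1 - \<alpha>)) * (exp \<eta> / (1 - exp \<eta>))) (at \<eta>)"
    if \<eta>: "Re \<eta> < 0" for \<eta>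
  proof -
    have "exp \<eta> \<noteq> 1" using e1[OF \<eta>] by (metis norm_one order_less_irrefl)
    \<comment> \<open>The double poles cancel in the difference, and 1 - (2\<alpha> - 1) = 2(1 -
      \<alpha>).\<close>
    have "(K has_field_derivative of_real (2 * (1 - \<alpha>)) / (1 - exp \<eta>)) (at (exp \<eta>))"
      unfolding K_def
      by (rule DERIV_cong[OF DERIV_diff[OF koebe_log_derivative koebe_log_derivative]])
         (use e1[OF \<eta>] in \<open>simp_all flip: diff_divide_distrib\<close>)
    then show ?thesis unfolding \<Phi>_def
      by (auto intro!: derivative_eq_intros DERIV_chain2[where f = K])
  qed
  have DG: "(G has_field_derivative exp \<eta> / (1 - exp \<eta>) *
      (1 + of_real (2 * (1 - \<alpha>)) * (exp \<eta> / (1 - exp \<eta>)))) (at \<eta>)"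
    if \<eta>: "Re \<eta> < 0" for \<eta>
  proof -
    have "exp \<eta> \<noteq> 1" using e1[OF \<eta>] by (metis norm_one order_less_irrefl)
    then have eq: "(of_real (2 * (1 - \<alpha>)) / (1 - exp \<eta>)\<^sup>2 + of_real (2 * \<alpha> - 1) / (1 - exp \<eta>)) * exp \<eta>
        = exp \<eta> / (1 - exp \<eta>) * (1 + of_real (2 * (1 - \<alpha>)) * (exp \<eta> / (1 - exp \<eta>)))"
      by (simp add: divide_simps power2_eq_square) (simp add: algebra_simps)
    show ?thesis unfolding G_def
      by (rule DERIV_cong[OF DERIV_chain2[OF koebe_log_derivative[OF e1[OF \<eta>]] DERIV_exp] eq])
  qed
  have "inj_on (\<lambda>\<eta>. \<Phi> \<eta> + of_real (2 * Re (G \<eta>))) {\<eta>. Re \<eta> < 0}"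
  proof (rule half_plane_starlike_inj[where c = "\<lambda>\<eta>. exp \<eta> / (1 - exp \<eta>)"])
    show "\<Phi> holomorphic_on {\<eta>. Re \<eta> < 0}"
      using D\<Phi> by (intro holomorphic_onI) (auto simp: field_differentiable_def intro: has_field_derivative_at_within)
    show "G holomorphic_on {\<eta>. Re \<eta> < 0}"
      using DG by (intro holomorphic_onI) (auto simp: field_differentiable_def intro: has_field_derivative_at_within)
    fix \<eta> :: complex assume "\<eta> \<in> {\<eta>. Re \<eta> < 0}"
    then have \<eta>: "Re \<eta> < 0" by simp
    show "0 < Re (deriv \<Phi> \<eta>)"
      unfolding DERIV_imp_deriv[OF D\<Phi>[OF \<eta>]] using Re_starlike_factor[OF e1[OF \<eta>] \<alpha>(2)] \<alpha>(1) by linarith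
    show "deriv G \<eta> = exp \<eta> / (1 - exp \<eta>) * deriv \<Phi> \<eta>"
      unfolding DERIV_imp_deriv[OF D\<Phi>[OF \<eta>]] DERIV_imp_deriv[OF DG[OF \<eta>]] ..
    show "0 < Re (1 + 2 * (exp \<eta> / (1 - exp \<eta>)))"
      by (rule Re_half_plane_map[OF e1[OF \<eta>]])
  next
    fix s :: real assume s: "s < 0"
    \<comment> \<open>The exponential maps Re \<eta> \<le> s into a closed disc inside the unit
      disc, where K is bounded, and \<Phi> \<eta> - \<eta> is K at exp \<eta>.\<close>
    have "exp s < 1" using s by simp
    then have "cball 0 (exp s) \<subseteq> ball (0::complex) 1"
      by (intro subsetI) (simp only: mem_cball_0 mem_ball_0)
    then have "compact (K ` cball 0 (exp s))"
      using holK by (intro compact_continuous_image)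
        (auto intro: continuous_on_subset holomorphic_on_imp_continuous_on)
    then obtain M where M: "\<And>w. w \<in> cball 0 (exp s) \<Longrightarrow> norm (K w) \<le> M"
      using compact_imp_bounded by (force simp: bounded_iff)
    have "\<forall>\<eta>. Re \<eta> \<le> s \<longrightarrow> norm (\<Phi> \<eta> - \<eta>) \<le> M"
      using M by (auto simp: \<Phi>_def)
    then show "\<exists>M. \<forall>\<eta>. Re \<eta> \<le> s \<longrightarrow> norm (\<Phi> \<eta> - \<eta>) \<le> M" by blast
  qed
  moreover have "\<eta> + koebe_log \<alpha> 1 (exp \<eta>) + cnj (koebe_log \<alpha> (2 * \<alpha> - 1) (exp \<eta>))
      = \<Phi> \<eta> + of_real (2 * Re (G \<eta>))" for \<eta>
  proof -
    have "of_real (2 * Re (G \<eta>)) = G \<eta> + cnj (G \<eta>)" by (simp add: complex_add_cnj)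
    then show ?thesis by (simp add: \<Phi>_def K_def G_def)
  qed
  ultimately show ?thesis by simp
qed

text \<open>For k = 1 and \<alpha> = 0 this is the logharmonic Koebe function z (1 -
  \<open>cnj z\<close>)/(1 - z) exp (4 Re (z/(1 - z))).\<close>

definition extremal :: "nat \<Rightarrow> real \<Rightarrow> complex \<Rightarrow> complex"
  where "extremal k \<alpha> z =
    z * exp (koebe_log \<alpha> 1 (z ^ k) / of_nat k) * cnj (exp (koebe_log \<alpha> (2 * \<alpha> - 1) (z ^ k) / of_nat k))"

text \<open>The quotient \<open>m div k\<close> recovers n from the full index n k that
  \<open>exp_gap_series\<close> uses.\<close>

definition extremal_coeff :: "nat \<Rightarrow> real \<Rightarrow> real \<Rightarrow> nat \<Rightarrow> complex"
  where "extremal_coeff k \<alpha> \<beta> m = of_real ((2 * (1 - \<alpha>) + \<beta> / real (m div k)) / real k)"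

text \<open>Equal values give values of F that differ by 2 pi i k m. By periodicity of exp, F
  commutes with translation by that amount, so the difference can be moved into the argument and
  injectivity of F applies.\<close>

lemma extremal_inj:
  assumes k: "k \<ge> 1" and \<alpha>: "0 \<le> \<alpha>" "\<alpha> < 1"
  shows "inj_on (extremal k \<alpha>) (ball 0 1)"
proof (rule inj_onI)
  define F where "F \<eta> = \<eta> + koebe_log \<alpha> 1 (exp \<eta>) + cnj (koebe_log \<alpha> (2 * \<alpha> - 1) (exp \<eta>))" for \<eta>
  have inj: "inj_on F {\<eta>. Re \<eta> < 0}" unfolding F_def by (rule koebe_log_inj[OF \<alpha>])
  have expF: "extremal k \<alpha> z = exp (F (of_nat k * Ln z) / of_nat k)" if "z \<noteq> 0" for z
  proof -
    have "exp (of_nat k * Ln z) = z ^ k" using that by (simp add: exp_of_nat_mult)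
    then have "F (of_nat k * Ln z) / of_nat k
        = Ln z + koebe_log \<alpha> 1 (z ^ k) / of_nat k + cnj (koebe_log \<alpha> (2 * \<alpha> - 1) (z ^ k) / of_nat k)"
      using k by (simp add: F_def add_divide_distrib)
    then show ?thesis using that by (simp add: extremal_def exp_add exp_cnj)
  qed
  have Re_neg: "Re (of_nat k * Ln z) < 0" if "norm z < 1" "z \<noteq> 0" for z
    using that k by (simp add: mult_less_0_iff)
  fix z1 z2 :: complex
  assume z: "z1 \<in> ball 0 1" "z2 \<in> ball 0 1" and eq: "extremal k \<alpha> z1 = extremal k \<alpha> z2"
  show "z1 = z2"
  proof (cases "z1 = 0 \<or> z2 = 0")
    case True
    then show ?thesis using eq by (auto simp: extremal_def)
  next
    case False
    then have nz: "z1 \<noteq> 0" "z2 \<noteq> 0" by auto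
    have "exp (F (of_nat k * Ln z1) / of_nat k) = exp (F (of_nat k * Ln z2) / of_nat k)"
      using eq expF nz by simp
    then obtain m :: int where m: "F (of_nat k * Ln z1) / of_nat k
        = F (of_nat k * Ln z2) / of_nat k + of_int (2 * m) * of_real pi * \<i>"
      unfolding exp_eq by (auto simp: mult.assoc)
    \<comment> \<open>k times another logarithm of z2: the shift is made before multiplying by k, so
      exp \<eta> is still z2^k.\<close>
    define \<eta> where "\<eta> = of_nat k * (Ln z2 + of_int (2 * m) * of_real pi * \<i>)"
    have "exp (of_int (2 * m) * of_real pi * \<i>) = (1::complex)"
      by (subst exp_eq_1) auto
    then have e: "exp (Ln z2 + of_int (2 * m) * of_real pi * \<i>) = z2"
      using nz by (simp only: exp_add) simp
    then have "exp \<eta> = exp (of_nat k * Ln z2)"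
      unfolding \<eta>_def exp_of_nat_mult using nz by simp
    then have "F \<eta> = F (of_nat k * Ln z2) + of_nat k * (of_int (2 * m) * of_real pi * \<i>)"
      by (simp add: F_def \<eta>_def algebra_simps)
    also have "\<dots> = F (of_nat k * Ln z1)" using m k by (simp add: field_simps)
    finally have "F \<eta> = F (of_nat k * Ln z1)" .
    moreover have "Re \<eta> < 0" using Re_neg[of z2] z nz k by (simp add: \<eta>_def)
    moreover have "Re (of_nat k * Ln z1) < 0" using Re_neg[of z1] z nz by simp
    ultimately have "\<eta> = of_nat k * Ln z1" using inj by (auto dest: inj_onD)
    then have "Ln z1 = Ln z2 + of_int (2 * m) * of_real pi * \<i>" using k by (simp add: \<eta>_def)
    then have "exp (Ln z1) = z2" using e by simp
    then show ?thesis using nz by simp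
  qed
qed

lemma extremal_exp_gap_series:
  assumes k: "k \<ge> 1"
  shows "exp_gap_series k (extremal_coeff k \<alpha> \<beta>) (\<lambda>z. exp (koebe_log \<alpha> \<beta> (z ^ k) / of_nat k))"
  unfolding exp_gap_series_def
proof (intro conjI ballI)
  have zk: "norm (z ^ k) < 1" if "norm z < 1" for z :: complex
    using that k by (simp add: norm_power power_less_one_iff)
  have "(\<lambda>z. koebe_log \<alpha> \<beta> (z ^ k)) holomorphic_on ball 0 1"
    using holomorphic_on_compose_gen[of "\<lambda>z. z ^ k" "ball 0 1", OF _ koebe_log_holomorphic[of \<alpha> \<beta>]] zk
    by (force simp: o_def intro!: holomorphic_intros)
  then show "(\<lambda>z. exp (koebe_log \<alpha> \<beta> (z ^ k) / of_nat k)) holomorphic_on ball 0 1"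
    by (intro holomorphic_intros) (use k in auto)
  fix z :: complex assume "z \<in> ball 0 1"
  then have z: "norm z < 1" by simp
  have "extremal_coeff k \<alpha> \<beta> (Suc n * k) * z ^ (Suc n * k)
      = of_real (2 * (1 - \<alpha>) + \<beta> / real (Suc n)) * (z ^ k) ^ Suc n / of_nat k" for n
  proof -
    have "Suc n * k div k = Suc n" using k by simp
    moreover have "z ^ (Suc n * k) = (z ^ k) ^ Suc n" by (metis mult.commute power_mult)
    ultimately show ?thesis by (simp only: extremal_coeff_def of_real_divide of_real_of_nat_eq times_divide_eq_left)
  qed
  then have "(\<lambda>n. extremal_coeff k \<alpha> \<beta> (Suc n * k) * z ^ (Suc n * k)) sums (koebe_log \<alpha> \<beta> (z ^ k) / of_nat k)"
    using sums_divide[OF koebe_log_sums[OF zk[OF z], of \<alpha> \<beta>], of "of_nat k"] by simp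
  then show "summable (\<lambda>n. extremal_coeff k \<alpha> \<beta> (Suc n * k) * z ^ (Suc n * k))"
    and "exp (koebe_log \<alpha> \<beta> (z ^ k) / of_nat k)
      = exp (\<Sum>n. extremal_coeff k \<alpha> \<beta> (Suc n * k) * z ^ (Suc n * k))"
    by (auto simp: sums_iff)
qed

lemma extremal_form:
  assumes k: "k \<ge> 1"
  shows "logharmonic_form k (extremal_coeff k \<alpha> 1) (extremal_coeff k \<alpha> (2 * \<alpha> - 1))
    (\<lambda>z. exp (koebe_log \<alpha> 1 (z ^ k) / of_nat k)) (\<lambda>z. exp (koebe_log \<alpha> (2 * \<alpha> - 1) (z ^ k) / of_nat k))
    (extremal k \<alpha>)"
  unfolding logharmonic_form_def using extremal_exp_gap_series[OF k] by (simp add: extremal_def)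

lemma extremal_logharmonic_starlike:
  assumes k: "k \<ge> 1" and \<alpha>: "0 \<le> \<alpha>" "\<alpha> < 1"
  shows "logharmonic_with (\<lambda>z. z ^ k) (extremal k \<alpha>)" and "starlike_of_order \<alpha> (extremal k \<alpha>)"
    and "continuous_on (ball 0 1) (extremal k \<alpha>)"
proof -
  define LA where "LA w = koebe_log \<alpha> 1 w / of_nat k" for w
  define LB where "LB w = koebe_log \<alpha> (2 * \<alpha> - 1) w / of_nat k" for w
  have holA: "LA holomorphic_on ball 0 1" and holB: "LB holomorphic_on ball 0 1"
    unfolding LA_def LB_def using k by (auto intro!: holomorphic_intros koebe_log_holomorphic)
  have form: "\<forall>z\<in>ball 0 1. extremal k \<alpha> z = z * exp (LA (z ^ k)) * cnj (exp (LB (z ^ k)))"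
    by (simp add: extremal_def LA_def LB_def)
  have zk: "norm (z ^ k) < 1" if "norm z < 1" for z :: complex
    using that k by (simp add: norm_power power_less_one_iff)
  define P where "P w = 1 + of_real (2 * (1 - \<alpha>)) * (w / (1 - w))" for w :: complex
  \<comment> \<open>These are X and Y. They satisfy Y = w X, so the dilatation is z^k, and X - Y =
    P.\<close>
  have dA: "1 + of_nat k * (w * deriv LA w) = P w / (1 - w)"
    and dB: "of_nat k * (w * deriv LB w) = w * P w / (1 - w)" if w: "norm w < 1" for w
  proof -
    have w1: "w \<noteq> 1" using w by auto
    have "deriv LA w = (of_real (2 * (1 - \<alpha>)) / (1 - w)\<^sup>2 + of_real 1 / (1 - w)) / of_nat k"
      unfolding LA_def by (intro DERIV_imp_deriv DERIV_cdivide koebe_log_derivative w)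
    then have "1 + of_nat k * (w * deriv LA w) = 1 + w * (of_real (2 * (1 - \<alpha>)) / (1 - w)\<^sup>2 + 1 / (1 - w))"
      using k by simp
    also have "\<dots> = P w / (1 - w)"
      using w1 unfolding P_def by (simp add: divide_simps power2_eq_square) (simp add: algebra_simps)
    finally show "1 + of_nat k * (w * deriv LA w) = P w / (1 - w)" .
    have "deriv LB w = (of_real (2 * (1 - \<alpha>)) / (1 - w)\<^sup>2 + of_real (2 * \<alpha> - 1) / (1 - w)) / of_nat k"
      unfolding LB_def by (intro DERIV_imp_deriv DERIV_cdivide koebe_log_derivative w)
    then have "of_nat k * (w * deriv LB w) = w * (of_real (2 * (1 - \<alpha>)) / (1 - w)\<^sup>2 + of_real (2 * \<alpha> - 1) / (1 - w))"
      using k by simp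
    also have "\<dots> = w * P w / (1 - w)"
      using w1 unfolding P_def by (simp add: divide_simps power2_eq_square) (simp add: algebra_simps)
    finally show "of_nat k * (w * deriv LB w) = w * P w / (1 - w)" .
  qed
  show "logharmonic_with (\<lambda>z. z ^ k) (extremal k \<alpha>)"
    unfolding logharmonic_with_def
  proof (intro conjI ballI impI)
    show "(\<lambda>z. z ^ k) holomorphic_on ball (0::complex) 1" by (intro holomorphic_intros)
    fix z :: complex assume "z \<in> ball 0 1"
    then have z: "norm z < 1" by simp
    show "norm (z ^ k) < 1" by (rule zk[OF z])
    show "extremal k \<alpha> differentiable at z" by (rule exp_gap_wirtinger(1)[OF k holA holB form z])
    assume "extremal k \<alpha> z \<noteq> 0"
    then have z0: "z \<noteq> 0" by (auto simp: extremal_def)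
    show "cnj (deriv_zbar (extremal k \<alpha>) z) / cnj (extremal k \<alpha> z)
        = z ^ k * (deriv_z (extremal k \<alpha>) z / extremal k \<alpha> z)"
      unfolding exp_gap_quotients(3)[OF k holA holB form z z0] dA[OF zk[OF z]] dB[OF zk[OF z]] by simp
  qed
  have quot: "starlike_quotient (extremal k \<alpha>) z = P (z ^ k) / (1 - z ^ k) - cnj (z ^ k * P (z ^ k) / (1 - z ^ k))"
    if z: "norm z < 1" "z \<noteq> 0" for z
    unfolding exp_gap_quotients(2)[OF k holA holB form z] dA[OF zk[OF z(1)]] dB[OF zk[OF z(1)]] ..
  show "starlike_of_order \<alpha> (extremal k \<alpha>)"
    unfolding starlike_of_order_def
  proof (intro conjI ballI exI)
    fix z :: complex assume "z \<in> ball 0 1 - {0}"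
    then have z: "norm z < 1" "z \<noteq> 0" by auto
    have "z ^ k \<noteq> 1" using zk[OF z(1)] by auto
    have "Re (starlike_quotient (extremal k \<alpha>) z) = Re (P (z ^ k) / (1 - z ^ k) - z ^ k * P (z ^ k) / (1 - z ^ k))"
      unfolding quot[OF z] by (simp only: minus_complex.sel cnj.sel)
    also have "P (z ^ k) / (1 - z ^ k) - z ^ k * P (z ^ k) / (1 - z ^ k) = P (z ^ k)"
      using \<open>z ^ k \<noteq> 1\<close> by (simp add: divide_simps) (simp add: algebra_simps)
    finally show "\<alpha> < Re (starlike_quotient (extremal k \<alpha>) z)"
      using Re_starlike_factor[OF zk[OF z(1)] \<alpha>(2)] by (simp only: P_def)
  next
    have "((\<lambda>z. P (z ^ k) / (1 - z ^ k) - cnj (z ^ k * P (z ^ k) / (1 - z ^ k))) \<longlongrightarrow> 1) (at 0)"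
      unfolding P_def using k by (auto intro!: tendsto_eq_intros simp: power_0_left)
    moreover have "\<forall>\<^sub>F z in at 0. P (z ^ k) / (1 - z ^ k) - cnj (z ^ k * P (z ^ k) / (1 - z ^ k))
        = starlike_quotient (extremal k \<alpha>) z"
      using eventually_at_in_open[OF open_ball, of 0 0 1] by (rule eventually_mono) (use quot in auto)
    ultimately show "(starlike_quotient (extremal k \<alpha>) \<longlongrightarrow> 1) (at 0)"
      by (rule Lim_transform_eventually)
  qed (use \<alpha> in simp)
  show "continuous_on (ball 0 1) (extremal k \<alpha>)"
    using exp_gap_wirtinger(1)[OF k holA holB form]
    by (intro differentiable_imp_continuous_on) (auto simp: differentiable_on_def intro: differentiable_at_withinI)
qed

lemma extremal_in_S_LH:
  assumes k: "k \<ge> 1" and \<alpha>: "0 \<le> \<alpha>" "\<alpha> < 1"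
  shows "extremal k \<alpha> \<in> S_LH k \<alpha>"
proof -
  have "fold_symmetric k (extremal k \<alpha>)"
  proof -
    have "cis (2 * pi / real k) ^ k = 1"
      using k by (simp add: Complex.DeMoivre)
    then show ?thesis by (simp add: fold_symmetric_def extremal_def power_mult_distrib)
  qed
  then show ?thesis
    unfolding S_LH_def logharmonic_def
    using extremal_logharmonic_starlike[OF assms] extremal_inj[OF assms] extremal_form[OF k, of \<alpha>] by blast
qed

text \<open>On the ray through u with u^k = -1 the variable w = -t^k is negative, where the growth
  bound is attained. The radial limit is a frontier point of exactly the required modulus.\<close>

lemma infdist_extremal_le:
  assumes k: "k \<ge> 1" and \<alpha>: "0 \<le> \<alpha>" "\<alpha> < 1"
  shows "infdist (extremal k \<alpha> 0) (frontier (extremal k \<alpha> ` ball 0 1)) \<le> exp (growth_exponent \<alpha> 1 / real k)"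
proof -
  define u where "u = cis (pi / real k)"
  have uk: "u ^ k = - 1" using k by (simp add: u_def Complex.DeMoivre)
  define y where "y = of_real (1 * exp (growth_exponent \<alpha> (1 ^ k) / real k)) * u"
  have val: "extremal k \<alpha> (of_real t * u) = of_real (t * exp (growth_exponent \<alpha> (t ^ k) / real k)) * u"
    if t: "0 < t" "t < 1" for t
  proof -
    have w: "(of_real t * u) ^ k = of_real (- (t ^ k))" by (simp add: power_mult_distrib uk)
    have lt: "- (t ^ k) < 1" using t by (simp add: add_pos_pos order.strict_trans[of _ 0])
    define A where "A = 2 * (1 - \<alpha>) * (- (t ^ k) / (1 - - (t ^ k))) - 1 * ln (1 - - (t ^ k))"
    define B where "B = 2 * (1 - \<alpha>) * (- (t ^ k) / (1 - - (t ^ k))) - (2 * \<alpha> - 1) * ln (1 - - (t ^ k))"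
    have "extremal k \<alpha> (of_real t * u) = of_real t * u * exp (of_real A / of_nat k) * cnj (exp (of_real B / of_nat k))"
      unfolding extremal_def w koebe_log_of_real[OF lt] A_def B_def ..
    also have "\<dots> = of_real t * u * of_real (exp (A / real k)) * of_real (exp (B / real k))"
    proof -
      have "exp (of_real C / of_nat k) = complex_of_real (exp (C / real k))" for C
        by (simp add: exp_of_real[symmetric])
      then show ?thesis by simp
    qed
    also have "\<dots> = of_real (t * exp ((A + B) / real k)) * u"
      by (simp add: add_divide_distrib exp_add)
    \<comment> \<open>The logarithms carry weights 1 and 2\<alpha> - 1, which add up to
      2\<alpha>.\<close>
    also have "A + B = growth_exponent \<alpha> (t ^ k)"
    proof -
      define q where "q = t ^ k / (1 + t ^ k)"
      have "- (t ^ k) / (1 - - (t ^ k)) = - q" by (simp add: q_def)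
      then show ?thesis
        unfolding A_def B_def growth_exponent_def q_def[symmetric] by (simp add: algebra_simps)
    qed
    finally show ?thesis .
  qed
  have "isCont (growth_exponent \<alpha>) (1 ^ k)"
    using DERIV_isCont[OF growth_exponent_derivative[of "1 ^ k" \<alpha>]] by simp
  then have "((\<lambda>t::real. growth_exponent \<alpha> (t ^ k)) \<longlongrightarrow> growth_exponent \<alpha> (1 ^ k)) (at_left 1)"
    by (rule isCont_tendsto_compose) (intro tendsto_intros)
  then have "((\<lambda>t. of_real (t * exp (growth_exponent \<alpha> (t ^ k) / real k)) * u) \<longlongrightarrow> y) (at_left 1)"
    unfolding y_def using k by (intro tendsto_intros) auto
  moreover have "\<forall>\<^sub>F t in at_left 1. of_real (t * exp (growth_exponent \<alpha> (t ^ k) / real k)) * u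
      = extremal k \<alpha> (of_real t * u)"
    by (rule eventually_at_leftI[of 0]) (use val in auto)
  ultimately have "((\<lambda>t. extremal k \<alpha> (of_real t * u)) \<longlongrightarrow> y) (at_left (1::real))"
    by (rule Lim_transform_eventually)
  then have "y \<in> frontier (extremal k \<alpha> ` ball 0 1)"
    by (intro radial_limit_in_frontier_image_disc[where u = u] extremal_inj
        extremal_logharmonic_starlike(3) assms) (auto simp: u_def)
  from infdist_le[OF this, of "extremal k \<alpha> 0"] show ?thesis
    by (simp add: extremal_def y_def norm_mult u_def)
qed

subsection \<open>The radius\<close>

text \<open>A + B + A B expanded in powers of 1/n; the value 0 at index 0 permits an unshifted power
  series.\<close>

definition bohr_coeff :: "real \<Rightarrow> nat \<Rightarrow> real"
  where "bohr_coeff \<alpha> n = (if n = 0 then 0 else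
    4 * (1 - \<alpha>) * (2 - \<alpha>) + 2 * \<alpha> * (3 - 2 * \<alpha>) / real n + (2 * \<alpha> - 1) / (real n)\<^sup>2)"

definition bohr_sum :: "real \<Rightarrow> real \<Rightarrow> real"
  where "bohr_sum \<alpha> x = (\<Sum>n. bohr_coeff \<alpha> n * x ^ n)"

lemma bohr_coeff_eq:
  fixes \<alpha> :: real
  assumes "0 < n"
  defines "A \<equiv> 2 * (1 - \<alpha>) + 1 / real n" and "B \<equiv> 2 * (1 - \<alpha>) + (2 * \<alpha> - 1) / real n"
  shows "bohr_coeff \<alpha> n = A + B + A * B"
  using assms(1) unfolding bohr_coeff_def A_def B_def
  by (simp add: divide_simps power2_eq_square) (simp add: algebra_simps)

text \<open>The second summand is negative only for \<alpha> < 1/2. Its modulus is then at most 1 -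
  2\<alpha>, which is below 2(1 - \<alpha>).\<close>

lemma extremal_b_coeff_nonneg:
  assumes "\<alpha> < 1" "0 \<le> \<alpha>"
  shows "0 \<le> 2 * (1 - \<alpha>) + (2 * \<alpha> - 1) / real (Suc n)"
proof -
  have "(1 - 2 * \<alpha>) / real (Suc n) \<le> 2 * (1 - \<alpha>) / 1"
    using assms by (intro frac_le) auto
  then show ?thesis by (simp add: diff_divide_distrib)
qed

lemma bohr_coeff_nonneg:
  assumes "0 \<le> \<alpha>" "\<alpha> < 1"
  shows "0 \<le> bohr_coeff \<alpha> n"
proof (cases "n = 0")
  case False
  then obtain m where m: "n = Suc m" by (cases n) auto
  have A: "0 \<le> 2 * (1 - \<alpha>) + 1 / real n"
    using assms by (intro add_nonneg_nonneg mult_nonneg_nonneg) auto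
  have B: "0 \<le> 2 * (1 - \<alpha>) + (2 * \<alpha> - 1) / real n"
    unfolding m by (rule extremal_b_coeff_nonneg[OF assms(2,1)])
  have "bohr_coeff \<alpha> n = (2 * (1 - \<alpha>) + 1 / real n) + (2 * (1 - \<alpha>) + (2 * \<alpha> - 1) / real n)
      + (2 * (1 - \<alpha>) + 1 / real n) * (2 * (1 - \<alpha>) + (2 * \<alpha> - 1) / real n)"
    using False by (intro bohr_coeff_eq) simp
  also have "\<dots> \<ge> 0"
    by (rule add_nonneg_nonneg[OF add_nonneg_nonneg[OF A B] mult_nonneg_nonneg[OF A B]])
  finally show ?thesis .
next
  case True
  then show ?thesis unfolding bohr_coeff_def by simp
qed

lemma bohr_sums_explicit:
  assumes "0 \<le> x" "x < 1"
  shows "(\<lambda>n. bohr_coeff \<alpha> n * x ^ n) sums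
    (4 * (1 - \<alpha>) * (2 - \<alpha>) * (x / (1 - x)) - 2 * \<alpha> * (3 - 2 * \<alpha>) * ln (1 - x) + (2 * \<alpha> - 1) * dilog x)"
proof -
  have 1: "(\<lambda>n. x ^ Suc n) sums (x / (1 - x))"
    using sums_mult[OF geometric_sums[of x], of x] assms by simp
  have "(\<lambda>n. - (x ^ n) / real n) sums ln (1 - x)"
    using ln_series'[of "- x"] assms by simp
  then have 2: "(\<lambda>n. - (x ^ Suc n) / real (Suc n)) sums ln (1 - x)"
    by (subst sums_Suc_iff) simp
  have "summable (\<lambda>n. x ^ Suc n / (real (Suc n))\<^sup>2)"
  proof (rule summable_comparison_test')
    show "norm (x ^ Suc n / (real (Suc n))\<^sup>2) \<le> x ^ Suc n" for n
    proof -
      have "x ^ Suc n / (real (Suc n))\<^sup>2 \<le> x ^ Suc n / 1"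
        using assms by (intro divide_left_mono) (auto simp del: power_Suc)
      then show ?thesis using assms by simp
    qed
  qed (use 1 in \<open>simp add: sums_iff\<close>)
  then have 3: "(\<lambda>n. x ^ Suc n / (real (Suc n))\<^sup>2) sums dilog x"
    unfolding dilog_def by (rule summable_sums)
  have "(\<lambda>n. 4 * (1 - \<alpha>) * (2 - \<alpha>) * x ^ Suc n - 2 * \<alpha> * (3 - 2 * \<alpha>) * (- (x ^ Suc n) / real (Suc n))
      + (2 * \<alpha> - 1) * (x ^ Suc n / (real (Suc n))\<^sup>2)) sums
    (4 * (1 - \<alpha>) * (2 - \<alpha>) * (x / (1 - x)) - 2 * \<alpha> * (3 - 2 * \<alpha>) * ln (1 - x) + (2 * \<alpha> - 1) * dilog x)"
    by (intro sums_add sums_diff sums_mult 1 2 3)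
  moreover have "4 * (1 - \<alpha>) * (2 - \<alpha>) * x ^ Suc n - 2 * \<alpha> * (3 - 2 * \<alpha>) * (- (x ^ Suc n) / real (Suc n))
      + (2 * \<alpha> - 1) * (x ^ Suc n / (real (Suc n))\<^sup>2) = bohr_coeff \<alpha> (Suc n) * x ^ Suc n" for n
    by (simp add: bohr_coeff_def distrib_right del: power_Suc of_nat_Suc)
  ultimately have "(\<lambda>n. bohr_coeff \<alpha> (Suc n) * x ^ Suc n) sums
    (4 * (1 - \<alpha>) * (2 - \<alpha>) * (x / (1 - x)) - 2 * \<alpha> * (3 - 2 * \<alpha>) * ln (1 - x) + (2 * \<alpha> - 1) * dilog x)"
    by (simp only:)
  then show ?thesis by (rule sums_Suc_imp[rotated]) (simp add: bohr_coeff_def)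
qed

lemma bohr_sum_summable:
  assumes "0 \<le> x" "x < 1"
  shows "summable (\<lambda>n. bohr_coeff \<alpha> n * x ^ n)"
  using bohr_sums_explicit[OF assms] by (rule sums_summable)

lemma bohr_sum_mono:
  assumes "0 \<le> \<alpha>" "\<alpha> < 1" "0 \<le> x" "x \<le> y" "y < 1"
  shows "bohr_sum \<alpha> x \<le> bohr_sum \<alpha> y"
  unfolding bohr_sum_def using assms
  by (intro suminf_le bohr_sum_summable mult_left_mono power_mono bohr_coeff_nonneg) auto

lemma bohr_sum_nonneg:
  assumes "0 \<le> \<alpha>" "\<alpha> < 1" "0 \<le> x" "x < 1"
  shows "0 \<le> bohr_sum \<alpha> x"
  unfolding bohr_sum_def using assms
  by (intro suminf_nonneg bohr_sum_summable) (auto intro!: mult_nonneg_nonneg bohr_coeff_nonneg)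

lemma bohr_sum_isCont:
  assumes "0 \<le> x" "x < 1"
  shows "isCont (bohr_sum \<alpha>) x"
  unfolding bohr_sum_def
  \<comment> \<open>Any K strictly between x and 1 would do.\<close>
  by (rule isCont_powser[where K = "(1 + x) / 2"], rule bohr_sum_summable) (use assms in auto)

lemma growth_exponent_1: "growth_exponent \<alpha> 1 = - (2 * \<alpha> * ln 2) - 2 * (1 - \<alpha>)"
  by (simp add: growth_exponent_def field_simps)

text \<open>Separates the reciprocal of the distance bound from the majorant. Monotonicity, the root
  and sharpness are all read off this form.\<close>

lemma bohr_function_eq:
  assumes "k \<ge> 1" "0 < r" "r < 1"
  shows "bohr_function k \<alpha> r = r * exp (- growth_exponent \<alpha> 1 / real k) * exp (bohr_sum \<alpha> (r ^ k) / real k)"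
proof -
  have x: "0 \<le> r ^ k" "r ^ k < 1" using assms by (auto simp: power_less_one_iff)
  define q l d where "q = r ^ k / (1 - r ^ k)" and "l = ln (1 - r ^ k)" and "d = dilog (r ^ k)"
  have S: "bohr_sum \<alpha> (r ^ k) = 4 * (1 - \<alpha>) * (2 - \<alpha>) * q - 2 * \<alpha> * (3 - 2 * \<alpha>) * l + (2 * \<alpha> - 1) * d"
    using bohr_sums_explicit[OF x, of \<alpha>] unfolding bohr_sum_def q_def l_def d_def by (simp add: sums_iff)
  have "bohr_function k \<alpha> r = r * exp (2 * \<alpha> / real k * ln 2) / exp (2 * \<alpha> * (3 - 2 * \<alpha>) / real k * l) *
      exp (1 / real k * (4 * (1 - \<alpha>) * (2 - \<alpha>) * q + (2 * \<alpha> - 1) * d + 2 * (1 - \<alpha>)))"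
    using x by (simp add: bohr_function_def powr_def q_def l_def d_def)
  also have "\<dots> = r * exp (2 * \<alpha> / real k * ln 2 - 2 * \<alpha> * (3 - 2 * \<alpha>) / real k * l +
      1 / real k * (4 * (1 - \<alpha>) * (2 - \<alpha>) * q + (2 * \<alpha> - 1) * d + 2 * (1 - \<alpha>)))"
    unfolding exp_add exp_diff by simp
  also have "2 * \<alpha> / real k * ln 2 - 2 * \<alpha> * (3 - 2 * \<alpha>) / real k * l +
      1 / real k * (4 * (1 - \<alpha>) * (2 - \<alpha>) * q + (2 * \<alpha> - 1) * d + 2 * (1 - \<alpha>))
      = - growth_exponent \<alpha> 1 / real k + bohr_sum \<alpha> (r ^ k) / real k"
    unfolding S growth_exponent_1 using assms(1) by (simp add: field_simps)
  finally show ?thesis by (simp only: exp_add mult.assoc)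
qed

lemma bohr_function_strict_mono:
  assumes k: "k \<ge> 1" and \<alpha>: "0 \<le> \<alpha>" "\<alpha> < 1" and rs: "0 < r" "r < s" "s < 1"
  shows "bohr_function k \<alpha> r < bohr_function k \<alpha> s"
proof -
  have "r ^ k \<le> s ^ k" "s ^ k < 1" "0 \<le> r ^ k"
    using k rs by (auto intro: power_mono simp: power_less_one_iff)
  then have "exp (bohr_sum \<alpha> (r ^ k) / real k) \<le> exp (bohr_sum \<alpha> (s ^ k) / real k)"
    using bohr_sum_mono[OF \<alpha>] by (simp add: divide_right_mono)
  then have "r * exp (- growth_exponent \<alpha> 1 / real k) * exp (bohr_sum \<alpha> (r ^ k) / real k)
      < s * exp (- growth_exponent \<alpha> 1 / real k) * exp (bohr_sum \<alpha> (s ^ k) / real k)"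
    using rs by (intro mult_less_le_imp_less) auto
  then show ?thesis using k rs by (simp add: bohr_function_eq)
qed

text \<open>At r equal to the distance bound d the first two factors cancel, leaving exp of a
  nonnegative sum. The intermediate value theorem thus works on [0, d] with d < 1, away from the
  singularity at 1.\<close>

lemma bohr_function_root:
  assumes k: "k \<ge> 1" and \<alpha>: "0 \<le> \<alpha>" "\<alpha> < 1"
  shows "\<exists>r. 0 < r \<and> r < 1 \<and> bohr_function k \<alpha> r = 1"
proof -
  define d where "d = exp (growth_exponent \<alpha> 1 / real k)"
  \<comment> \<open>Agrees with \<open>bohr_function\<close> on (0, 1) and is used on [0, d], where
    its value at 0 is 0.\<close>
  define \<phi> where "\<phi> r = r * exp (- growth_exponent \<alpha> 1 / real k) * exp (bohr_sum \<alpha> (r ^ k) / real k)" for r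
  have "0 \<le> 2 * \<alpha> * ln 2" using \<alpha> by simp
  then have "growth_exponent \<alpha> 1 \<le> 0 - 2 * (1 - \<alpha>)"
    unfolding growth_exponent_1 by (intro diff_right_mono) simp
  also have "\<dots> < 0" using \<alpha> by simp
  finally have "growth_exponent \<alpha> 1 < 0" .
  then have d: "0 < d" "d < 1" using k by (auto simp: d_def divide_neg_pos)
  have pk: "0 \<le> r ^ k" "r ^ k < 1" if "0 \<le> r" "r \<le> d" for r
    using that d k by (auto simp: power_less_one_iff)
  have "continuous_on {0..d} \<phi>"
    unfolding \<phi>_def
  proof (intro continuous_intros continuous_at_imp_continuous_on ballI)
    fix r assume "r \<in> {0..d}"
    then have "isCont (bohr_sum \<alpha>) (r ^ k)" using pk by (intro bohr_sum_isCont) auto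
    then show "isCont (\<lambda>r. bohr_sum \<alpha> (r ^ k)) r"
      by (rule isCont_o2[rotated]) (intro continuous_intros)
  qed (use k in auto)
  moreover have "\<phi> d = exp (bohr_sum \<alpha> (d ^ k) / real k)"
    by (simp add: \<phi>_def d_def exp_add[symmetric])
  then have "1 \<le> \<phi> d" using bohr_sum_nonneg[OF \<alpha> pk] d by simp
  moreover have "\<phi> 0 \<le> 1" by (simp add: \<phi>_def)
  ultimately obtain r where r: "0 \<le> r" "r \<le> d" "\<phi> r = 1"
    using IVT'[of \<phi> 0 1 d] d by auto
  have "0 < r" using r by (cases "r = 0") (auto simp: \<phi>_def)
  then show ?thesis using r d k bohr_function_eq[OF k, of r \<alpha>] by (auto simp: \<phi>_def)
qed

lemma bohr_function_eq_1:
  assumes "k \<ge> 1" "0 < r" "r < 1" "bohr_function k \<alpha> r = 1"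
  shows "r * exp (bohr_sum \<alpha> (r ^ k) / real k) = exp (growth_exponent \<alpha> 1 / real k)"
proof -
  define G where "G = growth_exponent \<alpha> 1 / real k"
  define S where "S = exp (bohr_sum \<alpha> (r ^ k) / real k)"
  have "r * exp (- G) * S = 1"
    using assms(4) bohr_function_eq[OF assms(1-3), of \<alpha>] by (simp only: G_def S_def minus_divide_left)
  then have "exp G * (r * exp (- G) * S) = exp G" by simp
  moreover have "exp G * (r * exp (- G) * S) = r * S * (exp G * exp (- G))" by (simp only: mult_ac)
  moreover have "exp G * exp (- G) = 1" by (simp add: exp_minus)
  ultimately have "r * S = exp G" by simp
  then show ?thesis by (simp only: G_def S_def)
qed

section \<open>The inequality and its sharpness\<close>

lemma bohr_sum_scaled_sums:
  assumes "k \<ge> 1" "0 \<le> r" "r < 1"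
  shows "(\<lambda>n. bohr_coeff \<alpha> (Suc n) / real k * r ^ (Suc n * k)) sums (bohr_sum \<alpha> (r ^ k) / real k)"
proof -
  have x: "0 \<le> r ^ k" "r ^ k < 1" using assms by (auto simp: power_less_one_iff)
  have "(\<lambda>n. bohr_coeff \<alpha> n * (r ^ k) ^ n) sums bohr_sum \<alpha> (r ^ k)"
    unfolding bohr_sum_def by (rule summable_sums[OF bohr_sum_summable[OF x]])
  then have "(\<lambda>n. bohr_coeff \<alpha> (Suc n) * (r ^ k) ^ Suc n) sums bohr_sum \<alpha> (r ^ k)"
    by (subst sums_Suc_iff) (simp add: bohr_coeff_def)
  from sums_divide[OF this, of "real k"]
  show ?thesis by (simp only: power_mult[symmetric] mult.commute[of k] times_divide_eq_left)
qed

text \<open>The triangle inequality removes \<theta>, since \<open>cis \<theta>\<close> has modulus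
  1. At the root the majorant equals the distance bound, and it increases with |z|.\<close>

lemma bohr_inequality_S_LH:
  assumes k: "k \<ge> 1" and \<alpha>: "0 \<le> \<alpha>" "\<alpha> < 1"
    and f: "f \<in> S_LH k \<alpha>" "logharmonic_form k a b h g f" "logharmonic_with \<omega> f"
    and r: "0 < r" "r < 1" "bohr_function k \<alpha> r = 1" and z: "norm z \<le> r"
  shows "bohr_inequality k a b f \<theta> z"
proof -
  note C = S_LH_bounds[OF k \<alpha> f]
  have z1: "norm z < 1" using z r by simp
  have term_le: "bohr_term k a b \<theta> z (Suc n) \<le> bohr_coeff \<alpha> (Suc n) / real k * norm z ^ (Suc n * k)" for n
  proof -
    define A where "A = 2 * (1 - \<alpha>) + 1 / real (Suc n)"
    define B where "B = 2 * (1 - \<alpha>) + (2 * \<alpha> - 1) / real (Suc n)"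
    have A: "0 \<le> A"
      unfolding A_def using \<alpha> by (intro add_nonneg_nonneg mult_nonneg_nonneg) auto
    define u where "u = a (Suc n * k)"
    define v where "v = b (Suc n * k)"
    have u: "norm u \<le> A / real k" and v: "norm v \<le> B / real k"
      using C(1,2)[of n] by (simp_all only: u_def v_def A_def B_def)
    have "norm (u + cis \<theta> * v + of_nat k * u * v) \<le> norm u + norm v + real k * norm u * norm v"
      by (intro norm_triangle_le add_mono) (simp_all add: norm_mult)
    also have "\<dots> \<le> A / real k + B / real k + real k * (A / real k) * (B / real k)"
      using u v A by (intro add_mono mult_mono) auto
    also have "\<dots> = bohr_coeff \<alpha> (Suc n) / real k"
      using k bohr_coeff_eq[of "Suc n" \<alpha>] by (simp only: A_def[symmetric] B_def[symmetric]) (simp add: field_simps)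
    finally show ?thesis
      unfolding bohr_term_def u_def v_def by (rule mult_right_mono) simp
  qed
  have term_nonneg: "0 \<le> bohr_term k a b \<theta> z n" for n by (simp add: bohr_term_def)
  note S = bohr_sum_scaled_sums[OF k norm_ge_zero z1, of \<alpha>]
  have summ: "summable (\<lambda>n. bohr_term k a b \<theta> z (Suc n))"
    by (rule summable_comparison_test'[OF sums_summable[OF S], of 0]) (use term_le term_nonneg in auto)
  have "(\<Sum>n. bohr_term k a b \<theta> z (Suc n)) \<le> bohr_sum \<alpha> (norm z ^ k) / real k"
    using suminf_le[OF term_le summ sums_summable[OF S]] sums_unique[OF S] by simp
  also have "\<dots> \<le> bohr_sum \<alpha> (r ^ k) / real k"
    using z r k by (intro divide_right_mono bohr_sum_mono \<alpha> power_mono) (auto simp: power_less_one_iff)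
  finally have "norm z * exp (\<Sum>n. bohr_term k a b \<theta> z (Suc n)) \<le> r * exp (bohr_sum \<alpha> (r ^ k) / real k)"
    using z r by (intro mult_mono) auto
  also have "\<dots> = exp (growth_exponent \<alpha> 1 / real k)" by (rule bohr_function_eq_1[OF k r])
  also note C(3)
  finally show ?thesis using summ by (simp add: bohr_inequality_def)
qed

text \<open>For \<theta> = 0 and z = r the coefficients are nonnegative reals, so the triangle
  inequality loses nothing and the series equals the majorant. With the distance at most exp
  (\<open>growth_exponent \<alpha> 1\<close> / k), the inequality becomes the stated bound.\<close>

lemma bohr_inequality_extremal:
  assumes k: "k \<ge> 1" and \<alpha>: "0 \<le> \<alpha>" "\<alpha> < 1" and r: "0 < r" "r < 1"
    and ineq: "bohr_inequality k (extremal_coeff k \<alpha> 1) (extremal_coeff k \<alpha> (2 * \<alpha> - 1)) (extremal k \<alpha>) 0 (of_real r)"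
  shows "bohr_function k \<alpha> r \<le> 1"
proof -
  have "bohr_term k (extremal_coeff k \<alpha> 1) (extremal_coeff k \<alpha> (2 * \<alpha> - 1)) 0 (of_real r) (Suc n)
      = bohr_coeff \<alpha> (Suc n) / real k * r ^ (Suc n * k)" for n
  proof -
    define A where "A = 2 * (1 - \<alpha>) + 1 / real (Suc n)"
    define B where "B = 2 * (1 - \<alpha>) + (2 * \<alpha> - 1) / real (Suc n)"
    have dv: "Suc n * k div k = Suc n" using k by simp
    have e: "bohr_coeff \<alpha> (Suc n) = A + B + A * B"
      using bohr_coeff_eq[of "Suc n" \<alpha>] by (simp only: A_def[symmetric] B_def[symmetric])
    have ab: "extremal_coeff k \<alpha> 1 (Suc n * k) = of_real (A / real k)"
        "extremal_coeff k \<alpha> (2 * \<alpha> - 1) (Suc n * k) = of_real (B / real k)"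
      unfolding extremal_coeff_def dv A_def B_def by simp_all
    have "of_real (A / real k) + cis 0 * of_real (B / real k)
        + of_nat k * of_real (A / real k) * of_real (B / real k)
        = complex_of_real (bohr_coeff \<alpha> (Suc n) / real k)"
      unfolding e using k by (simp add: field_simps)
    then show ?thesis
      unfolding bohr_term_def ab using bohr_coeff_nonneg[OF \<alpha>, of "Suc n"] r
      by (simp only: norm_of_real) simp
  qed
  then have "(\<Sum>n. bohr_term k (extremal_coeff k \<alpha> 1) (extremal_coeff k \<alpha> (2 * \<alpha> - 1)) 0 (of_real r) (Suc n))
      = bohr_sum \<alpha> (r ^ k) / real k"
    using sums_unique[OF bohr_sum_scaled_sums[OF k, of r \<alpha>]] r by simp
  then have "r * exp (bohr_sum \<alpha> (r ^ k) / real k) \<le> exp (growth_exponent \<alpha> 1 / real k)"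
    using ineq infdist_extremal_le[OF k \<alpha>] r by (simp add: bohr_inequality_def)
  then have "r * exp (bohr_sum \<alpha> (r ^ k) / real k) * exp (- growth_exponent \<alpha> 1 / real k)
      \<le> exp (growth_exponent \<alpha> 1 / real k) * exp (- growth_exponent \<alpha> 1 / real k)"
    by (rule mult_right_mono) simp
  also have "\<dots> = 1" by (simp add: exp_add[symmetric])
  finally show ?thesis unfolding bohr_function_eq[OF k r] by (simp add: mult_ac)
qed

text \<open>The singleton expresses existence and uniqueness of the root together. In the sharpness
  clause R may exceed 1, hence the separate bound |z| < 1.\<close>

theorem theorem6:
  fixes k :: nat and \<alpha> :: real
  assumes "k \<ge> 1" and "0 \<le> \<alpha>" and "\<alpha> < 1"
  shows "\<exists>r\<^sub>1. {r. 0 < r \<and> r < 1 \<and> bohr_function k \<alpha> r = 1} = {r\<^sub>1} \<and>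
    (\<forall>f \<omega> a b h g \<theta> z.
        f \<in> S_LH k \<alpha> \<and> logharmonic_form k a b h g f \<and> logharmonic_with \<omega> f \<and> \<omega> 0 = 0 \<and>
        norm z \<le> r\<^sub>1 \<longrightarrow> bohr_inequality k a b f \<theta> z) \<and>
    (\<forall>R > r\<^sub>1. \<not> (\<forall>f \<omega> a b h g \<theta> z.
        f \<in> S_LH k \<alpha> \<and> logharmonic_form k a b h g f \<and> logharmonic_with \<omega> f \<and> \<omega> 0 = 0 \<and>
        norm z < 1 \<and> norm z \<le> R \<longrightarrow> bohr_inequality k a b f \<theta> z))"
proof -
  note k = assms(1) and \<alpha> = assms(2,3)
  obtain r\<^sub>1 where r1: "0 < r\<^sub>1" "r\<^sub>1 < 1" "bohr_function k \<alpha> r\<^sub>1 = 1"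
    using bohr_function_root[OF assms] by blast
  have "{r. 0 < r \<and> r < 1 \<and> bohr_function k \<alpha> r = 1} = {r\<^sub>1}"
  proof -
    have "r = r\<^sub>1" if "0 < r" "r < 1" "bohr_function k \<alpha> r = 1" for r
      using bohr_function_strict_mono[OF assms, of r "r\<^sub>1"] bohr_function_strict_mono[OF assms, of "r\<^sub>1" r] r1 that
      by (cases r "r\<^sub>1" rule: linorder_cases) auto
    then show ?thesis using r1 by blast
  qed
  moreover have "\<not> (\<forall>f \<omega> a b h g \<theta> z.
      f \<in> S_LH k \<alpha> \<and> logharmonic_form k a b h g f \<and> logharmonic_with \<omega> f \<and> \<omega> 0 = 0 \<and>
      norm z < 1 \<and> norm z \<le> R \<longrightarrow> bohr_inequality k a b f \<theta> z)" if R: "R > r\<^sub>1" for R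
  proof
    assume all: "\<forall>f \<omega> a b h g \<theta> z.
      f \<in> S_LH k \<alpha> \<and> logharmonic_form k a b h g f \<and> logharmonic_with \<omega> f \<and> \<omega> 0 = 0 \<and>
      norm z < 1 \<and> norm z \<le> R \<longrightarrow> bohr_inequality k a b f \<theta> z"
    \<comment> \<open>Strictly between the root and 1, and at most R even if R is 1 or more.\<close>
    define r where "r = min R ((1 + r\<^sub>1) / 2)"
    have r: "r\<^sub>1 < r" "r < 1" "r \<le> R" using R r1 by (auto simp: r_def min_def)
    have "extremal k \<alpha> \<in> S_LH k \<alpha> \<and> logharmonic_form k (extremal_coeff k \<alpha> 1) (extremal_coeff k \<alpha> (2 * \<alpha> - 1))
        (\<lambda>z. exp (koebe_log \<alpha> 1 (z ^ k) / of_nat k)) (\<lambda>z. exp (koebe_log \<alpha> (2 * \<alpha> - 1) (z ^ k) / of_nat k))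
        (extremal k \<alpha>) \<and> logharmonic_with (\<lambda>z. z ^ k) (extremal k \<alpha>) \<and> (0::complex) ^ k = 0 \<and>
        norm (complex_of_real r) < 1 \<and> norm (complex_of_real r) \<le> R"
      by (intro conjI extremal_in_S_LH extremal_form extremal_logharmonic_starlike(1) assms)
        (use k r r1 in auto)
    from all[rule_format, OF this]
    have "bohr_inequality k (extremal_coeff k \<alpha> 1) (extremal_coeff k \<alpha> (2 * \<alpha> - 1)) (extremal k \<alpha>) 0 (of_real r)" .
    then have "bohr_function k \<alpha> r \<le> 1" using r r1 by (intro bohr_inequality_extremal assms) auto
    moreover have "bohr_function k \<alpha> r\<^sub>1 < bohr_function k \<alpha> r"
      by (rule bohr_function_strict_mono[OF assms r1(1) r(1,2)])
    ultimately show False using r1(3) by simp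
  qed
  moreover have "bohr_inequality k a b f \<theta> z"
    if "f \<in> S_LH k \<alpha> \<and> logharmonic_form k a b h g f \<and> logharmonic_with \<omega> f \<and> \<omega> 0 = 0 \<and> norm z \<le> r\<^sub>1"
    for f \<omega> a b h g \<theta> z
    using that by (intro bohr_inequality_S_LH[OF assms _ _ _ r1, of f a b h g \<omega>]) simp_all
  ultimately show ?thesis by (intro exI[of _ "r\<^sub>1"] conjI allI impI)
qed

end
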